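(* Let $H$ be a complex Hilbert space. Then the space $C_1(H)$ of trace class operators on $H$ satisfies the $\lambda$-property, i.e. $\lambda(a)>0$ for every $a\in\mathcal{B}_{C_1(H)}$, and the inequality $$\lambda(a)\geq\frac{1-\|a\|_1+2\|a\|_{\infty}}{2}$$ holds for every $a\in\mathcal{B}_{C_1(H)}$, where $\lambda$ is the $\lambda$-function of Aron and Lohman on the closed unit ball $\mathcal{B}_{C_1(H)}$.
   Context: $C_1(H)$ is the Banach space of trace class operators on $H$, i.e. compact operators $a$ on $H$ with $\|a\|_1:=\mathrm{tr}(|a|)<\infty$, where $|a|=(a^*a)^{1/2}$, equipped with the norm $\|\cdot\|_1$. $\|a\|_{\infty}$ denotes the operator norm of $a$ as an element of $B(H)$. For a Banach space $X$, $\mathcal{B}_X$ denotes its closed unit ball and $\partial_e(\mathcal{B}_X)$ the set of extreme points of $\mathcal{B}_X$, assumed nonempty. A triplet $(e,y,t)\in\partial_e(\mathcal{B}_X)\times\mathcal{B}_X\times[0,1]$ is amenable to $x\in\mathcal{B}_X$ if $x=te+(1-t)y$. The $\lambda$-function $\lambda:\mathcal{B}_X\to[0,\infty)$ is defined by $$\lambda(x):=\sup\{t : (e,y,t)\in\partial_e(\mathcal{B}_X)\times\mathcal{B}_X\times[0,1]\text{ is amenable to }x\}.$$ The space $X$ satisfies the $\lambda$-property if $\lambda(x)>0$ for every $x\in\mathcal{B}_X$. Here $X=C_1(H)$ with the norm $\|\cdot\|_1$. *)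

theory Defs
  imports "HOL-Analysis.Analysis"
begin

section \<open>Complex Hilbert spaces\<close>

text \<open>
  A complex inner product space is presented on top of the library's real inner product spaces:
  the underlying real inner product is the real part of the complex one. Positive definiteness
  of the complex form and the norm are therefore inherited from \<^class>\<open>real_inner\<close>. Every complex
  inner product space arises in this way, with \<open>inner x y = Re (cinner x y)\<close>. The
  complex inner product is linear in its first argument.
\<close>

class complex_inner = real_inner +
  fixes scaleC :: "complex \<Rightarrow> 'a \<Rightarrow> 'a"  (infixr "*\<^sub>C" 75)
    and cinner :: "'a \<Rightarrow> 'a \<Rightarrow> complex"
  assumes scaleR_scaleC: "r *\<^sub>R x = complex_of_real r *\<^sub>C x"
    and scaleC_add_right: "c *\<^sub>C (x + y) = c *\<^sub>C x + c *\<^sub>C y"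
    and scaleC_add_left: "(c + d) *\<^sub>C x = c *\<^sub>C x + d *\<^sub>C x"
    and scaleC_scaleC: "c *\<^sub>C d *\<^sub>C x = (c * d) *\<^sub>C x"
    and cinner_commute: "cinner x y = cnj (cinner y x)"
    and cinner_add_left: "cinner (x + y) z = cinner x z + cinner y z"
    and cinner_scaleC_left: "cinner (c *\<^sub>C x) y = c * cinner x y"
    and inner_eq_Re_cinner: "inner x y = Re (cinner x y)"

class chilbert_space = complex_inner + complete_space

instantiation complex :: chilbert_space
begin

definition scaleC_complex :: "complex \<Rightarrow> complex \<Rightarrow> complex" where
  "scaleC_complex c x = c * x"

definition cinner_complex :: "complex \<Rightarrow> complex \<Rightarrow> complex" where
  "cinner_complex x y = x * cnj y"

instance
  by standard
    (auto simp: scaleC_complex_def cinner_complex_def inner_complex_def scaleR_conv_of_real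
      algebra_simps)

end

section \<open>Trace class operators\<close>

text \<open>
  Elements of \<^typ>\<open>'a \<Rightarrow>\<^sub>L 'a\<close> are only real-linear; \<open>B(H)\<close> is the subset of the complex-linear
  ones, and its operator norm is the \<^const>\<open>norm\<close> of this type.
\<close>

definition bounded_operators :: "('a::chilbert_space \<Rightarrow>\<^sub>L 'a) set" where
  "bounded_operators = {a. \<forall>c x. blinfun_apply a (c *\<^sub>C x) = c *\<^sub>C blinfun_apply a x}"

definition cadjoint :: "('a::chilbert_space \<Rightarrow>\<^sub>L 'a) \<Rightarrow> ('a \<Rightarrow>\<^sub>L 'a)" where
  "cadjoint a = (THE b. b \<in> bounded_operators \<and>
     (\<forall>x y. cinner (blinfun_apply a x) y = cinner x (blinfun_apply b y)))"

definition positive_operator :: "('a::chilbert_space \<Rightarrow>\<^sub>L 'a) \<Rightarrow> bool" where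
  "positive_operator b \<longleftrightarrow>
     b \<in> bounded_operators \<and> (\<forall>x. cinner (blinfun_apply b x) x \<in> \<real>\<^sub>\<ge>\<^sub>0)"

definition positive_sqrt :: "('a::chilbert_space \<Rightarrow>\<^sub>L 'a) \<Rightarrow> ('a \<Rightarrow>\<^sub>L 'a)" where
  "positive_sqrt p = (THE b. positive_operator b \<and> b o\<^sub>L b = p)"

definition abs_operator :: "('a::chilbert_space \<Rightarrow>\<^sub>L 'a) \<Rightarrow> ('a \<Rightarrow>\<^sub>L 'a)" where
  "abs_operator a = positive_sqrt (cadjoint a o\<^sub>L a)"

definition compact_operator :: "('a::chilbert_space \<Rightarrow>\<^sub>L 'a) \<Rightarrow> bool" where
  "compact_operator a \<longleftrightarrow>
     a \<in> bounded_operators \<and> compact (closure (blinfun_apply a ` cball 0 1))"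

definition orthonormal_set :: "'a::chilbert_space set \<Rightarrow> bool" where
  "orthonormal_set E \<longleftrightarrow> (\<forall>x\<in>E. \<forall>y\<in>E. cinner x y = (if x = y then 1 else 0))"

definition orthonormal_basis :: "'a::chilbert_space set \<Rightarrow> bool" where
  "orthonormal_basis E \<longleftrightarrow>
     orthonormal_set E \<and> (\<forall>F. orthonormal_set F \<and> E \<subseteq> F \<longrightarrow> F = E)"

text \<open>
  The trace of a positive operator, with values in \<open>[0,\<infinity>]\<close>. It does not depend on the
  orthonormal basis, so an arbitrary one is chosen.
\<close>

definition pos_trace :: "('a::chilbert_space \<Rightarrow>\<^sub>L 'a) \<Rightarrow> ennreal" where
  "pos_trace b =
     (\<Sum>\<^sub>\<infinity>e\<in>(SOME E. orthonormal_basis E). ennreal (Re (cinner (blinfun_apply b e) e)))"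

definition trace_class :: "('a::chilbert_space \<Rightarrow>\<^sub>L 'a) set" where
  "trace_class = {a. compact_operator a \<and> pos_trace (abs_operator a) < \<infinity>}"

definition trace_norm :: "('a::chilbert_space \<Rightarrow>\<^sub>L 'a) \<Rightarrow> real" where
  "trace_norm a = enn2real (pos_trace (abs_operator a))"

section \<open>The \<open>\<lambda>\<close>-function of Aron and Lohman\<close>

text \<open>
  The normed space is given by a carrier \<open>X\<close>, a subspace of an ambient real vector space,
  together with a norm \<open>N\<close> on it. This is needed because the trace norm is not the
  \<^const>\<open>norm\<close> of the ambient type.
\<close>

definition unit_ball :: "'b::real_vector set \<Rightarrow> ('b \<Rightarrow> real) \<Rightarrow> 'b set" where
  "unit_ball X N = {x \<in> X. N x \<le> 1}"

definition amenable ::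
  "'b::real_vector set \<Rightarrow> ('b \<Rightarrow> real) \<Rightarrow> 'b \<Rightarrow> 'b \<Rightarrow> 'b \<Rightarrow> real \<Rightarrow> bool" where
  "amenable X N x e y t \<longleftrightarrow>
     e extreme_point_of unit_ball X N \<and> y \<in> unit_ball X N \<and> t \<in> {0..1} \<and>
     x = t *\<^sub>R e + (1 - t) *\<^sub>R y"

definition lambda_function :: "'b::real_vector set \<Rightarrow> ('b \<Rightarrow> real) \<Rightarrow> 'b \<Rightarrow> real" where
  "lambda_function X N x = Sup {t. \<exists>e y. amenable X N x e y t}"

text \<open>
  The \<open>\<lambda>\<close>-function is only meaningful if the unit ball has extreme points: otherwise the
  supremum is taken over the empty set. This standing requirement is made part of the
  property.
\<close>

definition lambda_property :: "'b::real_vector set \<Rightarrow> ('b \<Rightarrow> real) \<Rightarrow> bool" where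
  "lambda_property X N \<longleftrightarrow>
     (\<exists>e. e extreme_point_of unit_ball X N) \<and>
     (\<forall>x\<in>unit_ball X N. lambda_function X N x > 0)"

end

theory Submission
  imports Defs
begin

text \<open>
  Let \<open>s = norm a\<close> and let \<open>\<xi>\<close>, \<open>\<eta>\<close> be unit vectors with \<open>a \<xi> = s \<eta>\<close>; they exist since \<open>a\<close> is compact.
  Then \<open>\<xi>\<close> is an eigenvector of \<open>\<bar>a\<bar>\<close> for the eigenvalue \<open>s\<close>, and with \<open>e = \<langle>\<cdot>, \<xi>\<rangle> \<eta>\<close> and \<open>P\<close> the
  projection onto \<open>\<xi>\<close> one has \<open>\<bar>a + k e\<bar> = \<bar>a\<bar> + (\<bar>s + k\<bar> - s) P\<close>, because both sides are
  determined by the norms of the images of vectors. Taking traces, the trace norm of \<open>a + k e\<close> is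
  that of \<open>a\<close> plus \<open>\<bar>s + k\<bar> - s\<close>. Hence \<open>e\<close> is extreme in the unit ball: if \<open>e\<close> is a proper convex
  combination of \<open>y\<close> and \<open>z\<close>, then both map \<open>\<xi>\<close> to \<open>\<eta>\<close>, and the formula with \<open>k = -1\<close> gives
  \<open>y - e = 0 = z - e\<close>. For \<open>t = (1 - \<parallel>a\<parallel>\<^sub>1 + 2 s) / 2\<close> the same formula shows that \<open>a - t e\<close> has
  trace norm \<open>1 - t\<close>, so \<open>a\<close> is a convex combination of \<open>e\<close> and a point of the ball with weight \<open>t\<close>
  on \<open>e\<close>.
\<close>

section \<open>Real Hilbert spaces\<close>

text \<open>A sequence in \<open>M\<close> minimizing the distance to \<open>x\<close> is Cauchy by
  the parallelogram law. Its limit is a nearest point, and varying it inside \<open>M\<close> gives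
  orthogonality.\<close>

lemma subspace_orthogonal_projection:
  fixes M :: "'a::{real_inner, banach} set"
  assumes M: "subspace M" "closed M"
  obtains m where "m \<in> M" "\<And>y. y \<in> M \<Longrightarrow> inner (x - m) y = 0"
proof -
  define D where "D = infdist x M"
  have ne: "M \<noteq> {}" using M(1) subspace_0 by auto
  have lower: "D \<le> norm (x - y)" if "y \<in> M" for y
    unfolding D_def using infdist_le[OF that, of x] by (simp add: dist_norm)
  have D0: "D \<ge> 0" unfolding D_def by (rule infdist_nonneg)
  have "\<exists>y\<in>M. norm (x - y) < D + 1 / real (Suc n)" for n
  proof -
    have "Inf {dist x a |a. a \<in> M} < D + 1 / real (Suc n)"
      unfolding D_def infdist_def using ne by (simp add: image_def Collect_mem_eq setcompr_eq_image)
    then obtain d where "d \<in> {dist x a |a. a \<in> M}" "d < D + 1 / real (Suc n)"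
      using ne by (subst (asm) cInf_less_iff) (auto intro!: bdd_belowI[of _ 0])
    then show ?thesis by (auto simp: dist_norm)
  qed
  then obtain f where f: "\<And>n. f n \<in> M" "\<And>n. norm (x - f n) < D + 1 / real (Suc n)"
    by metis
  define \<delta> where "\<delta> n = 1 / real (Suc n)" for n
  have \<delta>: "0 < \<delta> n" "\<delta> n \<le> 1" for n by (auto simp: \<delta>_def)
  \<comment> \<open>Parallelogram law for \<open>x - f m\<close> and \<open>x - f n\<close>; the
    midpoint \<open>w\<close> stays in \<open>M\<close>, so its distance from \<open>x\<close> is at
    least \<open>D\<close>.\<close>
  have par: "(norm (f m - f n))\<^sup>2 \<le> 2 * ((D + \<delta> m)\<^sup>2 + (D + \<delta> n)\<^sup>2) - 4 * D\<^sup>2" for m n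
  proof -
    define w where "w = (1/2) *\<^sub>R (f m + f n)"
    have "w \<in> M" using M(1) f by (simp add: w_def subspace_add subspace_scale)
    from lower[OF this] have "D\<^sup>2 \<le> (norm (x - w))\<^sup>2"
      using D0 by (simp add: power_mono)
    moreover have "(norm (f m - f n))\<^sup>2 + 4 * (norm (x - w))\<^sup>2
        = 2 * ((norm (x - f m))\<^sup>2 + (norm (x - f n))\<^sup>2)"
      by (simp add: w_def power2_norm_eq_inner algebra_simps inner_commute)
    moreover have "(norm (x - f m))\<^sup>2 \<le> (D + \<delta> m)\<^sup>2" "(norm (x - f n))\<^sup>2 \<le> (D + \<delta> n)\<^sup>2"
      using f(2) by (auto intro!: power_mono intro: less_imp_le simp del: of_nat_Suc simp: \<delta>_def)
    ultimately show ?thesis by (smt (verit))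
  qed
  \<comment> \<open>The terms \<open>4 * D\<^sup>2\<close> cancel, and squares of \<delta> are
    absorbed because \<delta> is at most 1.\<close>
  have par': "(norm (f m - f n))\<^sup>2 \<le> (4 * D + 2) * (\<delta> m + \<delta> n)" for m n
  proof -
    have "\<delta> m ^ 2 \<le> \<delta> m" "\<delta> n ^ 2 \<le> \<delta> n"
      using \<delta> by (auto simp: power2_eq_square intro!: mult_left_le less_imp_le)
    then show ?thesis using par[of m n] by (simp add: power2_eq_square algebra_simps)
  qed
  have "Cauchy f"
  proof (rule CauchyI)
    fix e :: real assume e: "e > 0"
    have "\<delta> \<longlonglongrightarrow> 0" unfolding \<delta>_def using LIMSEQ_inverse_real_of_nat by (simp add: inverse_eq_divide)
    moreover have "e\<^sup>2 / (8 * D + 4) > 0" using e D0 by simp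
    ultimately obtain N where N: "\<And>n. n \<ge> N \<Longrightarrow> \<delta> n < e\<^sup>2 / (8 * D + 4)"
      by (metis (no_types, lifting) \<delta>(1) LIMSEQ_D abs_of_pos diff_zero real_norm_def)
    show "\<exists>M. \<forall>m\<ge>M. \<forall>n\<ge>M. norm (f m - f n) < e"
    proof (intro exI allI impI)
      fix m n assume "m \<ge> N" "n \<ge> N"
      then have "\<delta> m + \<delta> n < 2 * (e\<^sup>2 / (8 * D + 4))" using N[of m] N[of n] by linarith
      then have "(4 * D + 2) * (\<delta> m + \<delta> n) < (4 * D + 2) * (2 * (e\<^sup>2 / (8 * D + 4)))"
        using D0 by (intro mult_strict_left_mono) auto
      also have "\<dots> = e\<^sup>2" using D0 by (simp add: field_simps)
      finally show "norm (f m - f n) < e"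
        using par'[of m n] e by (meson le_less_trans less_imp_le power2_less_imp_less)
    qed
  qed
  then obtain m where m: "f \<longlonglongrightarrow> m" using Cauchy_convergent convergent_def by blast
  have mM: "m \<in> M" using M(2) f(1) m closed_sequentially by blast
  have "norm (x - m) \<le> D"
  proof (rule LIMSEQ_le)
    show "(\<lambda>n. norm (x - f n)) \<longlonglongrightarrow> norm (x - m)" by (intro tendsto_intros m)
    show "(\<lambda>n. D + 1 / real (Suc n)) \<longlonglongrightarrow> D"
      using tendsto_add[OF tendsto_const LIMSEQ_inverse_real_of_nat, of D] by (simp add: inverse_eq_divide)
    show "\<exists>N. \<forall>n\<ge>N. norm (x - f n) \<le> D + 1 / real (Suc n)" using f(2) less_imp_le by blast
  qed
  then have min: "norm (x - m) \<le> norm (x - y)" if "y \<in> M" for y using lower[OF that] by linarith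
  show ?thesis
  proof
    show "m \<in> M" by (rule mM)
    fix y assume y: "y \<in> M"
    show "inner (x - m) y = 0"
    proof (cases "y = 0")
      case False
      \<comment> \<open>This \<open>s\<close> minimizes the quadratic
        \<open>norm ((x - m) - s *\<^sub>R y)\<close>; minimality of \<open>m\<close> then leaves no
        room for a nonzero inner product.\<close>
      define s where "s = inner (x - m) y / (norm y)\<^sup>2"
      have "m + s *\<^sub>R y \<in> M" using mM y M(1) by (simp add: subspace_add subspace_scale)
      from min[OF this] have "(norm (x - m))\<^sup>2 \<le> (norm ((x - m) - s *\<^sub>R y))\<^sup>2"
        by (simp add: power_mono diff_diff_eq)
      also have "\<dots> = (norm (x - m))\<^sup>2 - 2 * s * inner (x - m) y + s\<^sup>2 * (norm y)\<^sup>2"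
        unfolding power2_norm_eq_inner
        by (simp add: inner_diff_left inner_diff_right power2_eq_square algebra_simps inner_commute)
      also have "\<dots> = (norm (x - m))\<^sup>2 - (inner (x - m) y)\<^sup>2 / (norm y)\<^sup>2"
        using False by (simp add: s_def power2_eq_square field_simps)
      finally have "(inner (x - m) y)\<^sup>2 / (norm y)\<^sup>2 \<le> 0" by simp
      then show ?thesis using False by (simp add: divide_le_0_iff)
    qed simp
  qed
qed

text \<open>A vector \<open>w\<close> orthogonal to the kernel of \<open>f\<close> represents
  \<open>f\<close> up to a factor, since subtracting \<open>(f x / f w) *\<^sub>R w\<close> moves
  any \<open>x\<close> into the kernel.\<close>

lemma riesz_representation:
  fixes f :: "'a::{real_inner, banach} \<Rightarrow> real"
  assumes "bounded_linear f"
  obtains z where "\<And>x. f x = inner x z"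
proof (cases "\<forall>x. f x = 0")
  case True
  then show ?thesis using that[of 0] by simp
next
  case False
  then obtain v where v: "f v \<noteq> 0" by blast
  interpret f: bounded_linear f by fact
  have "closed {x. f x = 0}"
    by (intro closed_Collect_eq f.continuous_on continuous_on_id continuous_on_const)
  moreover have "subspace {x. f x = 0}"
    by (auto simp: subspace_def f.add f.scaleR f.zero)
  ultimately obtain m where m: "f m = 0" "\<And>y. f y = 0 \<Longrightarrow> inner (v - m) y = 0"
    using subspace_orthogonal_projection[of "{x. f x = 0}" v] by auto
  define w where "w = v - m"
  have fw: "f w \<noteq> 0" using v m by (simp add: w_def f.diff)
  then have w0: "w \<noteq> 0" by (auto simp: f.zero)
  have "f x = inner x ((f w / inner w w) *\<^sub>R w)" for x
  proof -
    have "f (x - (f x / f w) *\<^sub>R w) = 0" using fw by (simp add: f.diff f.scaleR)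
    from m(2)[OF this] have "inner w (x - (f x / f w) *\<^sub>R w) = 0" by (simp add: w_def)
    then show ?thesis using fw w0 by (simp add: inner_diff_right field_simps inner_commute)
  qed
  then show ?thesis using that by blast
qed

text \<open>Riesz gives the value at each \<open>y\<close>; linearity follows from uniqueness of the
  representing vector, and boundedness from testing with \<open>x = g y\<close>.\<close>

lemma blinfun_adjoint_exists:
  fixes a :: "'a::{real_inner, banach} \<Rightarrow>\<^sub>L 'b::real_inner"
  obtains b :: "'b \<Rightarrow>\<^sub>L 'a" where "\<And>x y. inner (a x) y = inner x (b y)"
proof -
  have "\<exists>z. \<forall>x. inner (a x) y = inner x z" for y
  proof -
    have "bounded_linear (\<lambda>x. inner (a x) y)"
      by (rule bounded_linear_compose[OF bounded_linear_inner_left blinfun.bounded_linear_right])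
    then show ?thesis using riesz_representation by metis
  qed
  then obtain g where g: "\<And>x y. inner (a x) y = inner x (g y)" by metis
  have "bounded_linear g"
  proof (rule bounded_linear_intro)
    show "g (x + y) = g x + g y" for x y
      by (rule vector_eq_ldot[THEN iffD1]) (simp add: inner_add_right flip: g)
    show "g (r *\<^sub>R x) = r *\<^sub>R g x" for r x
      by (rule vector_eq_ldot[THEN iffD1]) (simp flip: g)
    show "norm (g y) \<le> norm y * norm a" for y
    proof (cases "g y = 0")
      case False
      have "(norm (g y))\<^sup>2 = inner (a (g y)) y" by (simp add: g power2_norm_eq_inner)
      also have "\<dots> \<le> norm (a (g y)) * norm y" by (rule norm_cauchy_schwarz)
      also have "\<dots> \<le> norm a * norm (g y) * norm y" by (intro mult_right_mono norm_blinfun) auto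
      finally show ?thesis using False by (simp add: power2_eq_square mult.commute)
    qed simp
  qed
  then show ?thesis using that[of "Blinfun g"] g by (simp add: bounded_linear_Blinfun_apply)
qed

section \<open>Square roots of positive operators\<close>

text \<open>Symmetry is a separate conjunct because over the reals a nonnegative quadratic form does
  not imply it.\<close>

definition psd :: "('a::real_inner \<Rightarrow>\<^sub>L 'a) \<Rightarrow> bool" where
  "psd p \<longleftrightarrow> (\<forall>x y. inner (p x) y = inner x (p y)) \<and> (\<forall>x. 0 \<le> inner (p x) x)"

text \<open>Evaluate the form at \<open>x - (1/c) *\<^sub>R p x\<close> and bound the term
  containing \<open>p (p x)\<close> by \<open>c * (norm (p x))\<^sup>2\<close>.\<close>

lemma psd_norm_apply_le:
  assumes "psd p" "norm p \<le> c"
  shows "(norm (p x))\<^sup>2 \<le> c * inner (p x) x"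
proof (cases "c = 0")
  case True
  then show ?thesis using assms by simp
next
  case False
  then have c: "c > 0" using assms norm_ge_zero[of p] by linarith
  have sym: "\<And>x y. inner (p x) y = inner x (p y)" and pos: "\<And>x. 0 \<le> inner (p x) x"
    using assms by (auto simp: psd_def)
  have "inner (p (p x)) (p x) \<le> norm (p (p x)) * norm (p x)" by (rule norm_cauchy_schwarz)
  also have "\<dots> \<le> (c * norm (p x)) * norm (p x)"
    using assms(2) norm_blinfun[of p "p x"] by (meson mult_right_mono norm_ge_zero order_trans)
  finally have le: "inner (p (p x)) (p x) \<le> c * (norm (p x))\<^sup>2" by (simp add: power2_eq_square)
  have "0 \<le> inner (p (x - (1/c) *\<^sub>R p x)) (x - (1/c) *\<^sub>R p x)" by (rule pos)
  also have "\<dots> = inner (p x) x - 2/c * (norm (p x))\<^sup>2 + (1/c)\<^sup>2 * inner (p (p x)) (p x)"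
    unfolding power2_norm_eq_inner using sym[of x "p x"] sym[of "p x" x]
    by (simp add: blinfun.diff_right blinfun.scaleR_right inner_diff_left inner_diff_right
        power2_eq_square algebra_simps)
  also have "\<dots> \<le> inner (p x) x - 2/c * (norm (p x))\<^sup>2 + (1/c)\<^sup>2 * (c * (norm (p x))\<^sup>2)"
    using le by (intro add_left_mono mult_left_mono) auto
  also have "\<dots> = inner (p x) x - (norm (p x))\<^sup>2 / c" using c by (simp add: power2_eq_square field_simps)
  finally show ?thesis using c by (simp add: field_simps)
qed

lemma psd_apply_eq_0:
  assumes "psd p" "inner (p x) x = 0"
  shows "p x = 0"
  using psd_norm_apply_le[OF assms(1) order_refl, of x] assms(2) by simp

text \<open>
  The root of \<open>p = c (1 - T)\<close> is \<open>sqrt c (1 - L)\<close>, where \<open>L\<close> solves \<open>L = (T + L\<^sup>2) / 2\<close>. The iteration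
  \<open>X\<close> for this fixed point converges because its increments are bounded by those of the scalar
  iteration \<open>r\<close> with \<open>T\<close> replaced by \<open>1\<close>.
\<close>

lemma psd_sqrt_exists:
  fixes p :: "'a::{real_inner, banach} \<Rightarrow>\<^sub>L 'a"
  assumes p: "psd p"
  obtains b where "psd b" "b o\<^sub>L b = p" "\<And>s. s o\<^sub>L p = p o\<^sub>L s \<Longrightarrow> s o\<^sub>L b = b o\<^sub>L s"
proof -
  have sym: "\<And>x y. inner (p x) y = inner x (p y)" and pos: "\<And>x. 0 \<le> inner (p x) x"
    using p by (auto simp: psd_def)
  \<comment> \<open>The summand 1 keeps \<open>c\<close> positive even for
    \<open>p = 0\<close>.\<close>
  define c where "c = norm p + 1"
  have c: "c > 0" by (simp add: c_def add_nonneg_pos)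
  define T where "T = id_blinfun - (1/c) *\<^sub>R p"
  have T: "T x = x - (1/c) *\<^sub>R p x" for x
    by (simp add: T_def blinfun.diff_left blinfun.scaleR_left)
  \<comment> \<open>In the expansion of \<open>(norm (T x))\<^sup>2\<close> the quadratic term in
    \<open>p\<close> costs at most half of the negative linear term.\<close>
  have normT: "norm T \<le> 1"
  proof (rule norm_blinfun_bound)
    fix x
    have "(norm (T x))\<^sup>2 = (norm x)\<^sup>2 - 2/c * inner (p x) x + (norm (p x))\<^sup>2 / c\<^sup>2"
      unfolding power2_norm_eq_inner T
      by (simp add: inner_diff_left inner_diff_right algebra_simps inner_commute power2_eq_square)
    also have "\<dots> \<le> (norm x)\<^sup>2 - 2/c * inner (p x) x + (c * inner (p x) x) / c\<^sup>2"
      using psd_norm_apply_le[OF p, of c x] by (intro add_left_mono divide_right_mono) (auto simp: c_def)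
    also have "\<dots> = (norm x)\<^sup>2 - inner (p x) x / c" using c by (simp add: power2_eq_square field_simps)
    also have "\<dots> \<le> (norm x)\<^sup>2" using pos c by simp
    finally show "norm (T x) \<le> 1 * norm x" by (simp add: power2_le_iff_abs_le)
  qed simp
  define X where "X = rec_nat 0 (\<lambda>_ x. (1/2) *\<^sub>R (T + (x o\<^sub>L x)))"
  define r :: "nat \<Rightarrow> real" where "r = rec_nat 0 (\<lambda>_ x. (1 + x\<^sup>2) / 2)"
  have X0: "X 0 = 0" and XS: "X (Suc n) = (1/2) *\<^sub>R (T + (X n o\<^sub>L X n))" for n
    by (auto simp: X_def)
  have r0: "r 0 = 0" and rS: "r (Suc n) = (1 + (r n)\<^sup>2) / 2" for n
    by (auto simp: r_def)
  have r_bounds: "0 \<le> r n \<and> r n \<le> 1" for n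
  proof (induction n)
    case (Suc n)
    then have "(r n)\<^sup>2 \<le> 1" by (simp add: power_le_one)
    then show ?case by (simp add: rS)
  qed (simp add: r0)
  have "r n \<le> r (Suc n)" for n
    using zero_le_power2[of "r n - 1"] by (simp add: rS power2_eq_square algebra_simps)
  then have "incseq r" by (simp add: incseq_SucI)
  then obtain l where l: "r \<longlonglongrightarrow> l" using r_bounds incseq_convergent[of r 1] by blast
  have normX: "norm (X n) \<le> r n" for n
  proof (induction n)
    case (Suc n)
    have "norm (X n o\<^sub>L X n) \<le> (r n)\<^sup>2"
      using norm_blinfun_compose[of "X n" "X n"] Suc r_bounds[of n]
      by (smt (verit, ccfv_SIG) mult_mono norm_ge_zero power2_eq_square)
    then have "norm (T + (X n o\<^sub>L X n)) \<le> 1 + (r n)\<^sup>2" by (rule norm_triangle_mono[OF normT])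
    then show ?case by (simp add: XS rS)
  qed (simp add: X0 r0)
  \<comment> \<open>The difference of the squares of consecutive iterates \<open>B\<close> and
    \<open>A\<close> is written as \<open>B (B - A) + (B - A) A\<close>, which is valid without
    commutativity. The scalars \<open>r\<close> satisfy the same recursion with equality.\<close>
  have diffX: "norm (X (Suc n) - X n) \<le> r (Suc n) - r n" for n
  proof (induction n)
    case 0
    show ?case using normX[of 1] by (simp add: X0 r0)
  next
    case (Suc n)
    have "X (Suc (Suc n)) - X (Suc n) = (1/2) *\<^sub>R ((X (Suc n) o\<^sub>L X (Suc n)) - (X n o\<^sub>L X n))"
      by (simp add: XS[of "Suc n"] XS[of n] scaleR_right_diff_distrib[symmetric])
    also have "(X (Suc n) o\<^sub>L X (Suc n)) - (X n o\<^sub>L X n)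
        = (X (Suc n) o\<^sub>L (X (Suc n) - X n)) + ((X (Suc n) - X n) o\<^sub>L X n)"
      by (rule blinfun_eqI) (simp add: blinfun.diff_left blinfun.add_left blinfun.diff_right)
    finally have eq: "X (Suc (Suc n)) - X (Suc n)
        = (1/2) *\<^sub>R ((X (Suc n) o\<^sub>L (X (Suc n) - X n)) + ((X (Suc n) - X n) o\<^sub>L X n))" .
    have "norm (X (Suc n) o\<^sub>L (X (Suc n) - X n)) \<le> r (Suc n) * (r (Suc n) - r n)"
      using norm_blinfun_compose[of "X (Suc n)" "X (Suc n) - X n"] normX[of "Suc n"] Suc
        r_bounds[of "Suc n"] by (smt (verit, ccfv_SIG) mult_mono norm_ge_zero)
    moreover have "norm ((X (Suc n) - X n) o\<^sub>L X n) \<le> (r (Suc n) - r n) * r n"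
      using norm_blinfun_compose[of "X (Suc n) - X n" "X n"] normX[of n] Suc
        r_bounds[of n] by (smt (verit, ccfv_SIG) mult_mono norm_ge_zero)
    ultimately have "norm ((X (Suc n) o\<^sub>L (X (Suc n) - X n)) + ((X (Suc n) - X n) o\<^sub>L X n))
        \<le> r (Suc n) * (r (Suc n) - r n) + (r (Suc n) - r n) * r n"
      by (rule norm_triangle_mono)
    moreover have "r (Suc (Suc n)) - r (Suc n)
        = 1/2 * (r (Suc n) * (r (Suc n) - r n) + (r (Suc n) - r n) * r n)"
      by (simp add: rS power2_eq_square field_simps)
    ultimately show ?case unfolding eq norm_scaleR by (simp del: scaleR_add_right)
  qed
  have "summable (\<lambda>n. r (Suc n) - r n)" using telescope_summable[OF l] .
  then have "summable (\<lambda>n. X (Suc n) - X n)" by (rule summable_comparison_test') (rule diffX)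
  then have "convergent (\<lambda>n. \<Sum>i<n. X (Suc i) - X i)" by (simp add: summable_iff_convergent)
  then have "convergent X" by (simp add: sum_lessThan_telescope X0)
  then obtain L where L: "X \<longlonglongrightarrow> L" by (auto simp: convergent_def)
  note tendsto_comp = bounded_bilinear.tendsto[OF bounded_bilinear_blinfun_compose]
  have "(\<lambda>n. (1/2) *\<^sub>R (T + (X n o\<^sub>L X n))) \<longlonglongrightarrow> (1/2) *\<^sub>R (T + (L o\<^sub>L L))"
    by (intro tendsto_intros tendsto_comp L)
  then have Leq: "L = (1/2) *\<^sub>R (T + (L o\<^sub>L L))"
    using LIMSEQ_Suc[OF L] by (simp add: XS LIMSEQ_unique)
  \<comment> \<open>Rearranged, this says that the square of \<open>1 - L\<close> is
    \<open>(1/c) *\<^sub>R p\<close>.\<close>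
  have Leq': "2 *\<^sub>R L x = x - (1/c) *\<^sub>R p x + L (L x)" for x
  proof -
    have "L x = (1/2) *\<^sub>R (x - (1/c) *\<^sub>R p x + L (L x))"
      using arg_cong[OF Leq, of "\<lambda>f. f x"] by (simp add: blinfun.scaleR_left blinfun.add_left T)
    then have "2 *\<^sub>R L x = 2 *\<^sub>R (1/2) *\<^sub>R (x - (1/c) *\<^sub>R p x + L (L x))" by (rule arg_cong)
    then show ?thesis by (simp only: scaleR_scaleR) simp
  qed
  have "norm L \<le> 1"
    by (intro LIMSEQ_le_const2[OF tendsto_norm[OF L]] exI allI impI)
      (rule order_trans[OF normX conjunct2[OF r_bounds]])
  have symX: "inner (X n x) y = inner x (X n y)" for n x y
  proof (induction n arbitrary: x y)
    case (Suc n)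
    have "inner (T x) y = inner x (T y)" by (simp add: T inner_diff_left inner_diff_right sym)
    then show ?case by (simp add: XS blinfun.scaleR_left blinfun.add_left inner_add_left inner_add_right Suc)
  qed (simp add: X0)
  have symL: "inner (L x) y = inner x (L y)" for x y
  proof (rule LIMSEQ_unique)
    show "(\<lambda>n. inner (X n x) y) \<longlonglongrightarrow> inner (L x) y" by (intro tendsto_intros L)
    show "(\<lambda>n. inner (X n x) y) \<longlonglongrightarrow> inner x (L y)" unfolding symX by (intro tendsto_intros L)
  qed
  define b where "b = sqrt c *\<^sub>R (id_blinfun - L)"
  have b: "b x = sqrt c *\<^sub>R (x - L x)" for x
    by (simp add: b_def blinfun.diff_left blinfun.scaleR_left)
  show ?thesis
  proof
    have "inner (L x) x \<le> inner x x" for x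
    proof -
      have "inner (L x) x \<le> norm (L x) * norm x" by (rule norm_cauchy_schwarz)
      also have "\<dots> \<le> norm x * norm x"
        using norm_blinfun[of L x] mult_right_mono[OF \<open>norm L \<le> 1\<close> norm_ge_zero[of x]]
        by (intro mult_right_mono) auto
      finally show ?thesis by (simp add: dot_square_norm power2_eq_square)
    qed
    then show "psd b"
      using c by (auto simp: psd_def b inner_diff_left inner_diff_right symL)
    show "b o\<^sub>L b = p"
    proof (rule blinfun_eqI)
      fix x
      have "(b o\<^sub>L b) x = c *\<^sub>R (x - 2 *\<^sub>R L x + L (L x))"
        using c by (simp add: b blinfun.diff_right blinfun.scaleR_right algebra_simps scaleR_2)
      also have "\<dots> = p x" unfolding Leq' using c by simp
      finally show "(b o\<^sub>L b) x = p x" .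
    qed
    \<comment> \<open>Every iterate is a polynomial in \<open>p\<close>, so \<open>s\<close>
      commutes with it, and commutation survives the norm limit.\<close>
    fix s assume "s o\<^sub>L p = p o\<^sub>L s"
    then have sp: "s (p x) = p (s x)" for x by (metis blinfun_apply_blinfun_compose)
    have "s (X n x) = X n (s x)" for n x
      by (induction n arbitrary: x)
        (simp_all add: X0 XS T blinfun.scaleR_left blinfun.add_left blinfun.scaleR_right
          blinfun.add_right blinfun.diff_right sp)
    then have "s o\<^sub>L X n = X n o\<^sub>L s" for n by (intro blinfun_eqI) simp
    moreover have "(\<lambda>n. s o\<^sub>L X n) \<longlonglongrightarrow> (s o\<^sub>L L)" by (intro tendsto_comp tendsto_const L)
    moreover have "(\<lambda>n. X n o\<^sub>L s) \<longlonglongrightarrow> (L o\<^sub>L s)" by (intro tendsto_comp tendsto_const L)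
    ultimately have "s o\<^sub>L L = L o\<^sub>L s" by (simp add: LIMSEQ_unique)
    then have "s (L x) = L (s x)" for x by (metis blinfun_apply_blinfun_compose)
    then show "s o\<^sub>L b = b o\<^sub>L s"
      by (intro blinfun_eqI) (simp add: b blinfun.scaleR_right blinfun.diff_right)
  qed
qed

text \<open>Both roots are compared with the root \<open>q\<close> from the existence lemma. A root
  \<open>u\<close> commutes with its own square, hence with \<open>q\<close>, so
  \<open>u + q\<close> kills \<open>y = u x - q x\<close>. Both forms then vanish at
  \<open>y\<close>, so \<open>u y = q y = 0\<close>, and symmetry gives
  \<open>inner y y = 0\<close>.\<close>

lemma psd_sqrt_unique:
  fixes b d :: "'a::{real_inner, banach} \<Rightarrow>\<^sub>L 'a"
  assumes b: "psd b" and d: "psd d" and eq: "b o\<^sub>L b = d o\<^sub>L d"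
  shows "b = d"
proof -
  have "psd (b o\<^sub>L b)" using b unfolding psd_def by (metis blinfun_apply_blinfun_compose inner_ge_zero)
  then obtain q where q: "psd q" "q o\<^sub>L q = b o\<^sub>L b"
    "\<And>s. s o\<^sub>L (b o\<^sub>L b) = (b o\<^sub>L b) o\<^sub>L s \<Longrightarrow> s o\<^sub>L q = q o\<^sub>L s"
    using psd_sqrt_exists by blast
  have *: "u = q" if u: "psd u" and sq: "u o\<^sub>L u = q o\<^sub>L q" for u
  proof (rule blinfun_eqI)
    fix x
    have "u o\<^sub>L q = q o\<^sub>L u"
      by (rule q(3)) (simp add: q(2)[symmetric] sq[symmetric] blinfun_compose.rep_eq blinfun_eqI)
    then have comm: "u (q z) = q (u z)" for z by (metis blinfun_apply_blinfun_compose)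
    have sq': "u (u z) = q (q z)" for z using sq by (metis blinfun_apply_blinfun_compose)
    define y where "y = u x - q x"
    have "u y + q y = 0" by (simp add: y_def blinfun.diff_right comm sq')
    then have "inner (u y) y + inner (q y) y = 0" by (metis inner_add_left inner_zero_left)
    moreover have "inner (u y) y \<ge> 0" "inner (q y) y \<ge> 0" using u q(1) unfolding psd_def by blast+
    ultimately have "inner (u y) y = 0" "inner (q y) y = 0" by linarith+
    then have "u y = 0" "q y = 0" using psd_apply_eq_0 u q(1) by blast+
    moreover have "inner y y = inner x (u y - q y)"
      using u q(1) by (simp add: psd_def y_def inner_diff_left inner_diff_right blinfun.diff_right)
    ultimately show "u x = q x" by (simp add: y_def)
  qed
  show ?thesis by (metis * b d eq q(2))
qed

section \<open>Operators on complex Hilbert spaces\<close>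

instance chilbert_space \<subseteq> banach ..

lemma cinner_add_right: "cinner x (y + z :: 'a::complex_inner) = cinner x y + cinner x z"
  by (metis cinner_add_left cinner_commute complex_cnj_add)

lemma cinner_scaleC_right: "cinner x (c *\<^sub>C y :: 'a::complex_inner) = cnj c * cinner x y"
  by (metis cinner_commute cinner_scaleC_left complex_cnj_mult)

lemma cinner_scaleR_left: "cinner (r *\<^sub>R x :: 'a::complex_inner) y = of_real r * cinner x y"
  by (simp add: scaleR_scaleC cinner_scaleC_left)

lemma cinner_scaleR_right: "cinner x (r *\<^sub>R y :: 'a::complex_inner) = of_real r * cinner x y"
  by (simp add: scaleR_scaleC cinner_scaleC_right)

lemma cinner_zero_left: "cinner (0 :: 'a::complex_inner) x = 0"
  using cinner_scaleR_left[of 0 x x] by simp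

lemma cinner_diff_left: "cinner (x - y :: 'a::complex_inner) z = cinner x z - cinner y z"
  using cinner_add_left[of "x - y" y z] by (simp add: eq_diff_eq)

lemma cinner_diff_right: "cinner z (x - y :: 'a::complex_inner) = cinner z x - cinner z y"
  using cinner_add_right[of z "x - y" y] by (simp add: eq_diff_eq)

lemma cinner_sum_left: "cinner (\<Sum>i\<in>F. f i :: 'a::complex_inner) z = (\<Sum>i\<in>F. cinner (f i) z)"
  by (induction F rule: infinite_finite_induct) (auto simp: cinner_zero_left cinner_add_left)

lemma inner_scaleC_left: "inner (c *\<^sub>C x) y = inner x (cnj c *\<^sub>C y :: 'a::complex_inner)"
  by (simp add: inner_eq_Re_cinner cinner_scaleC_left cinner_scaleC_right)

lemma Im_cinner: "Im (cinner x y) = inner x (\<i> *\<^sub>C y :: 'a::complex_inner)"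
  by (simp add: inner_eq_Re_cinner cinner_scaleC_right)

text \<open>The imaginary part of the form is a real inner product with
  \<open>\<i> *\<^sub>C y\<close>, so identities proved in the real theory transfer to the complex
  form.\<close>

lemma cinner_eqI:
  assumes "inner x y = inner z (w :: 'a::complex_inner)"
    and "inner x (\<i> *\<^sub>C y) = inner z (\<i> *\<^sub>C w)"
  shows "cinner x y = cinner z w"
  using assms by (intro complex_eqI) (simp_all add: Im_cinner inner_eq_Re_cinner)

lemma cinner_same: "cinner x (x :: 'a::complex_inner) = of_real ((norm x)\<^sup>2)"
proof (rule complex_eqI)
  have "Im (cinner x x) = - Im (cinner x x)"
    by (subst cinner_commute) simp
  then show "Im (cinner x x) = Im (of_real ((norm x)\<^sup>2))" by simp
qed (simp add: power2_norm_eq_inner inner_eq_Re_cinner)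

lemma norm_scaleC: "norm (c *\<^sub>C x :: 'a::complex_inner) = cmod c * norm x"
proof -
  have "complex_of_real ((norm (c *\<^sub>C x))\<^sup>2) = cinner (c *\<^sub>C x) (c *\<^sub>C x)"
    by (simp only: cinner_same)
  also have "\<dots> = (c * cnj c) * cinner x x"
    by (simp add: cinner_scaleC_left cinner_scaleC_right)
  also have "\<dots> = complex_of_real ((cmod c * norm x)\<^sup>2)"
    by (simp only: cinner_same power_mult_distrib of_real_mult complex_norm_square)
  finally have "(norm (c *\<^sub>C x))\<^sup>2 = (cmod c * norm x)\<^sup>2" by (simp only: of_real_eq_iff)
  then show ?thesis by (simp add: power2_eq_iff_nonneg)
qed

text \<open>Rotating \<open>x\<close> by the phase \<open>u\<close> makes the form real and
  nonnegative; the real inequality then applies.\<close>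

lemma cinner_cauchy_schwarz: "cmod (cinner x y) \<le> norm x * norm (y :: 'a::complex_inner)"
proof (cases "cinner x y = 0")
  case False
  define u where "u = cnj (cinner x y) / of_real (cmod (cinner x y))"
  have u: "cmod u = 1" using False by (simp add: u_def norm_divide)
  have "cnj (cinner x y) * cinner x y = of_real (cmod (cinner x y)) * of_real (cmod (cinner x y))"
    using complex_norm_square[of "cinner x y"] by (simp add: power2_eq_square mult.commute)
  then have "u * cinner x y = of_real (cmod (cinner x y))"
    using False by (simp add: u_def)
  then have "cmod (cinner x y) = inner (u *\<^sub>C x) y"
    by (simp add: inner_eq_Re_cinner cinner_scaleC_left)
  also have "\<dots> \<le> norm (u *\<^sub>C x) * norm y" by (rule norm_cauchy_schwarz)
  finally show ?thesis by (simp add: norm_scaleC u)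
qed (simp add: mult_nonneg_nonneg)

lemma bounded_linear_scaleC: "bounded_linear (\<lambda>x :: 'a::complex_inner. c *\<^sub>C x)"
  by (rule bounded_linear_intro[of _ "cmod c"])
    (simp_all add: scaleC_add_right scaleR_scaleC scaleC_scaleC norm_scaleC mult.commute)

lemma bounded_linear_scaleC_left: "bounded_linear (\<lambda>c. c *\<^sub>C (x :: 'a::complex_inner))"
  by (rule bounded_linear_intro[of _ "norm x"])
    (simp_all add: scaleC_add_left scaleR_scaleC[of _ "c *\<^sub>C x" for c] scaleC_scaleC
      scaleR_conv_of_real norm_scaleC)

lemma bounded_linear_cinner_left: "bounded_linear (\<lambda>x :: 'a::complex_inner. cinner x y)"
  by (rule bounded_linear_intro[of _ "norm y"])
    (simp_all add: cinner_add_left cinner_scaleR_left scaleR_conv_of_real cinner_cauchy_schwarz)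

section \<open>Complex-linear operators, adjoints and absolute values\<close>

lemma bounded_operatorsD: "a \<in> bounded_operators \<Longrightarrow> a (c *\<^sub>C x) = c *\<^sub>C a x"
  by (simp add: bounded_operators_def)

lemma bounded_operators_0: "0 \<in> bounded_operators"
  by (simp add: bounded_operators_def, metis bounded_linear.linear bounded_linear_scaleC linear_0)

lemma bounded_operators_add:
  "a \<in> bounded_operators \<Longrightarrow> b \<in> bounded_operators \<Longrightarrow> a + b \<in> bounded_operators"
  by (simp add: bounded_operators_def blinfun.add_left scaleC_add_right)

lemma bounded_operators_scaleR:
  "a \<in> bounded_operators \<Longrightarrow> r *\<^sub>R a \<in> bounded_operators"
  by (simp add: bounded_operators_def blinfun.scaleR_left scaleR_scaleC scaleC_scaleC mult.commute)

lemma bounded_operators_compose: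
  "a \<in> bounded_operators \<Longrightarrow> b \<in> bounded_operators \<Longrightarrow> a o\<^sub>L b \<in> bounded_operators"
  by (simp add: bounded_operators_def)

text \<open>The real adjoint works: moving the scalar \<open>c\<close> to the other side as
  \<open>cnj c\<close> shows that it is complex-linear.\<close>

lemma bounded_operator_adjoint_exists:
  fixes a :: "'a::chilbert_space \<Rightarrow>\<^sub>L 'a"
  assumes a: "a \<in> bounded_operators"
  obtains b :: "'a \<Rightarrow>\<^sub>L 'a"
    where "b \<in> bounded_operators" "\<And>x y. cinner (a x) y = cinner x (b y)"
proof -
  obtain b :: "'a \<Rightarrow>\<^sub>L 'a" where b: "\<And>x y. inner (a x) y = inner x (b y)"
    using blinfun_adjoint_exists by blast
  have lin: "b (c *\<^sub>C y) = c *\<^sub>C b y" for c y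
  proof (rule vector_eq_ldot[THEN iffD1], rule allI)
    fix x
    have "inner x (b (c *\<^sub>C y)) = inner (a (cnj c *\<^sub>C x)) y"
      by (simp add: bounded_operatorsD[OF a] inner_scaleC_left flip: b)
    also have "\<dots> = inner x (c *\<^sub>C b y)" by (simp add: b inner_scaleC_left)
    finally show "inner x (b (c *\<^sub>C y)) = inner x (c *\<^sub>C b y)" .
  qed
  have "cinner (a x) y = cinner x (b y)" for x y
    by (rule cinner_eqI) (simp_all add: b lin)
  then show ?thesis using that[of b] lin by (simp add: bounded_operators_def)
qed

text \<open>The description in \<open>cadjoint\<close> is well defined because real inner products
  already determine an adjoint.\<close>

lemma cadjoint:
  assumes a: "a \<in> bounded_operators"
  shows cadjoint_bounded_operators: "cadjoint a \<in> bounded_operators"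
    and cinner_cadjoint: "cinner (a x) y = cinner x (cadjoint a y)"
proof -
  obtain b where b: "b \<in> bounded_operators" "\<And>x y. cinner (a x) y = cinner x (b y)"
    using bounded_operator_adjoint_exists[OF a] by blast
  have "cadjoint a = b" unfolding cadjoint_def
  proof (rule the_equality)
    fix d assume d: "d \<in> bounded_operators \<and> (\<forall>x y. cinner (a x) y = cinner x (d y))"
    have "inner x (d y) = inner x (b y)" for x y
      using d b by (metis inner_eq_Re_cinner)
    then show "d = b" by (intro blinfun_eqI) (metis vector_eq_ldot)
  qed (use b in auto)
  with b show "cadjoint a \<in> bounded_operators" "cinner (a x) y = cinner x (cadjoint a y)"
    by auto
qed

lemma inner_cadjoint:
  "a \<in> bounded_operators \<Longrightarrow> inner (a x) y = inner x (cadjoint a y)"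
  by (simp add: inner_eq_Re_cinner cinner_cadjoint)

lemma norm_cadjoint_apply_le:
  assumes a: "a \<in> bounded_operators"
  shows "norm (cadjoint a y) \<le> norm a * norm y"
proof (cases "cadjoint a y = 0")
  case False
  have "(norm (cadjoint a y))\<^sup>2 = inner (a (cadjoint a y)) y"
    by (simp add: inner_cadjoint[OF a] power2_norm_eq_inner)
  also have "\<dots> \<le> norm (a (cadjoint a y)) * norm y" by (rule norm_cauchy_schwarz)
  also have "\<dots> \<le> norm a * norm (cadjoint a y) * norm y" by (intro mult_right_mono norm_blinfun) auto
  finally show ?thesis using False by (simp add: power2_eq_square mult.commute)
qed simp

text \<open>This gives access to the real square root theory. The point is that a real-valued
  complex quadratic form forces symmetry, by polarization.\<close>

lemma positive_operator_iff: "positive_operator b \<longleftrightarrow> b \<in> bounded_operators \<and> psd b"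
proof (intro iffI conjI)
  assume pos: "positive_operator b"
  then show b: "b \<in> bounded_operators" by (simp add: positive_operator_def)
  have Im0: "inner (b x) (\<i> *\<^sub>C x) = 0" and Re0: "0 \<le> inner (b x) x" for x
    using pos by (auto simp: positive_operator_def complex_nonneg_Reals_iff Im_cinner inner_eq_Re_cinner)
  have skew: "inner (b x) (\<i> *\<^sub>C y) = - inner (b y) (\<i> *\<^sub>C x)" for x y
    using Im0[of "x + y"] Im0[of x] Im0[of y]
    by (simp add: scaleC_add_right blinfun.add_right inner_add_left inner_add_right)
  have "inner (b x) y = inner x (b y)" for x y
  proof -
    \<comment> \<open>Inserting \<open>(- \<i>) *\<^sub>C y\<close> for \<open>y\<close> removes the
      factor \<open>\<i>\<close> and turns skewness into symmetry.\<close>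
    have "inner (b x) (\<i> *\<^sub>C (- \<i>) *\<^sub>C y) = - inner (b ((- \<i>) *\<^sub>C y)) (\<i> *\<^sub>C x)" by (rule skew)
    also have "\<dots> = inner (b y) x"
      by (simp add: bounded_operatorsD[OF b] inner_eq_Re_cinner cinner_scaleC_left cinner_scaleC_right)
    finally have "inner (b x) y = inner (b y) x"
      by (simp add: inner_eq_Re_cinner cinner_scaleC_left cinner_scaleC_right)
    then show ?thesis by (simp only: inner_commute)
  qed
  then show "psd b" using Re0 by (simp add: psd_def)
next
  assume "b \<in> bounded_operators \<and> psd b"
  then have b: "b \<in> bounded_operators" and sym: "\<And>x y. inner (b x) y = inner x (b y)"
    and pos: "\<And>x. 0 \<le> inner (b x) x" by (auto simp: psd_def)
  have "cinner (b x) x \<in> \<real>\<^sub>\<ge>\<^sub>0" for x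
  proof -
    have "cinner (b x) x = cinner x (b x)"
      by (rule cinner_eqI) (simp_all add: sym bounded_operatorsD[OF b])
    also have "\<dots> = cnj (cinner (b x) x)" by (rule cinner_commute)
    finally have "Im (cinner (b x) x) = Im (cnj (cinner (b x) x))" by (rule arg_cong)
    then show ?thesis using pos[of x] by (simp add: complex_nonneg_Reals_iff inner_eq_Re_cinner)
  qed
  then show "positive_operator b" using b by (simp add: positive_operator_def)
qed

lemma positive_operator_cinner_commute:
  assumes "positive_operator b"
  shows "cinner (b x) y = cinner x (b y)"
  using assms by (intro cinner_eqI) (auto simp: positive_operator_iff psd_def bounded_operatorsD)

text \<open>The real root commutes with whatever commutes with \<open>p\<close>, in particular with
  multiplication by complex scalars, so it is complex-linear.\<close>

lemma positive_operator_sqrt_exists: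
  assumes "positive_operator p"
  obtains b where "positive_operator b" "b o\<^sub>L b = p"
proof -
  have p: "p \<in> bounded_operators" "psd p" using assms by (auto simp: positive_operator_iff)
  obtain b where b: "psd b" "b o\<^sub>L b = p" "\<And>s. s o\<^sub>L p = p o\<^sub>L s \<Longrightarrow> s o\<^sub>L b = b o\<^sub>L s"
    using psd_sqrt_exists[OF p(2)] by blast
  have "b (c *\<^sub>C x) = c *\<^sub>C b x" for c x
  proof -
    define s where "s = Blinfun (\<lambda>x :: 'a. c *\<^sub>C x)"
    have s: "s x = c *\<^sub>C x" for x
      by (simp add: s_def bounded_linear_Blinfun_apply bounded_linear_scaleC)
    have "s o\<^sub>L b = b o\<^sub>L s"
      by (intro b(3) blinfun_eqI) (simp add: s bounded_operatorsD[OF p(1)])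
    then show ?thesis by (metis blinfun_apply_blinfun_compose s)
  qed
  then show ?thesis using that[of b] b(1,2) by (simp add: positive_operator_iff bounded_operators_def)
qed

text \<open>Identifies absolute values without computing square roots: by polarization, equal norms
  of all images mean that \<open>c o\<^sub>L c\<close> is \<open>cadjoint a o\<^sub>L a\<close>, and
  positive roots are unique.\<close>

lemma abs_operator_iff:
  assumes a: "a \<in> bounded_operators"
  shows "abs_operator a = c \<longleftrightarrow> positive_operator c \<and> (\<forall>x. norm (c x) = norm (a x))"
proof -
  define p where "p = cadjoint a o\<^sub>L a"
  have p: "inner x (p y) = inner (a x) (a y)" for x y
    by (simp add: p_def inner_cadjoint[OF a])
  have "psd p" unfolding psd_def by (metis p inner_commute inner_ge_zero)
  moreover have "p \<in> bounded_operators"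
    unfolding p_def by (intro bounded_operators_compose cadjoint_bounded_operators a)
  ultimately obtain b where b: "positive_operator b" "b o\<^sub>L b = p"
    using positive_operator_sqrt_exists positive_operator_iff by blast
  have abs: "abs_operator a = b"
    unfolding abs_operator_def positive_sqrt_def p_def[symmetric]
    by (rule the_equality) (use b psd_sqrt_unique positive_operator_iff in metis)+
  have sq: "c o\<^sub>L c = p \<longleftrightarrow> (\<forall>x. norm (c x) = norm (a x))" if c: "positive_operator c" for c
  proof -
    have cc: "inner x (c (c y)) = inner (c x) (c y)" for x y
      using c by (simp add: positive_operator_iff psd_def)
    show ?thesis
    proof
      assume "c o\<^sub>L c = p"
      then have "inner (c x) (c x) = inner (a x) (a x)" for x
        by (metis p cc blinfun_apply_blinfun_compose)
      then show "\<forall>x. norm (c x) = norm (a x)" by (simp add: norm_eq_sqrt_inner)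
    next
      assume n: "\<forall>x. norm (c x) = norm (a x)"
      have "inner x (c (c y)) = inner x (p y)" for x y
        unfolding cc p using n by (simp add: dot_norm flip: blinfun.add_right)
      then show "c o\<^sub>L c = p" by (intro blinfun_eqI) (metis vector_eq_ldot blinfun_apply_blinfun_compose)
    qed
  qed
  show ?thesis
    unfolding abs using b sq psd_sqrt_unique positive_operator_iff by metis
qed

lemma positive_abs_operator: "a \<in> bounded_operators \<Longrightarrow> positive_operator (abs_operator a)"
  and norm_abs_operator_apply: "a \<in> bounded_operators \<Longrightarrow> norm (abs_operator a x) = norm (a x)"
  using abs_operator_iff by blast+

section \<open>The trace of positive operators\<close>

lemma orthonormal_basis_exists: "\<exists>E :: 'a::chilbert_space set. orthonormal_basis E"
proof -
  have "\<exists>M\<in>{E. orthonormal_set E}. \<forall>X\<in>{E :: 'a set. orthonormal_set E}. M \<subseteq> X \<longrightarrow> X = M"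
  proof (rule subset_Zorn')
    fix C :: "'a set set" assume C: "subset.chain {E. orthonormal_set E} C"
    have "cinner x y = (if x = y then 1 else 0)" if xy: "x \<in> \<Union>C" "y \<in> \<Union>C" for x y
    proof -
      obtain X Y where X: "x \<in> X" "X \<in> C" and Y: "y \<in> Y" "Y \<in> C" using xy by blast
      have "X \<subseteq> Y \<or> Y \<subseteq> X" using C X Y by (auto simp: subset.chain_def)
      then obtain Z where "x \<in> Z" "y \<in> Z" "Z \<in> C" using X Y by (metis subsetD)
      moreover have "orthonormal_set Z" using C \<open>Z \<in> C\<close> by (auto simp: subset.chain_def)
      ultimately show ?thesis by (simp add: orthonormal_set_def)
    qed
    then show "\<Union>C \<in> {E. orthonormal_set E}" by (simp add: orthonormal_set_def)
  qed
  then show ?thesis by (auto simp: orthonormal_basis_def)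
qed

section \<open>Finite Fourier sums and Parseval's identity\<close>

definition fourier_sum :: "'a::chilbert_space set \<Rightarrow> 'a \<Rightarrow> 'a" where
  "fourier_sum F x = (\<Sum>e\<in>F. cinner x e *\<^sub>C e)"

lemma cinner_diff_fourier_sum:
  assumes F: "orthonormal_set F" "finite F" and e: "e \<in> F"
  shows "cinner (x - fourier_sum F x) e = 0"
proof -
  have "cinner (fourier_sum F x) e = (\<Sum>f\<in>F. if f = e then cinner x e else 0)"
    unfolding fourier_sum_def cinner_sum_left cinner_scaleC_left
    using F e by (intro sum.cong) (auto simp: orthonormal_set_def)
  also have "\<dots> = cinner x e" using F e by simp
  finally show ?thesis by (simp add: cinner_diff_left)
qed

text \<open>Pythagoras: the residual is orthogonal to the Fourier sum.\<close>

lemma norm_diff_fourier_sum: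
  assumes F: "orthonormal_set F" "finite F"
  shows "(norm (x - fourier_sum F x))\<^sup>2 = (norm x)\<^sup>2 - (\<Sum>e\<in>F. (cmod (cinner x e))\<^sup>2)"
proof -
  have sum_right: "cinner z (fourier_sum F x) = (\<Sum>e\<in>F. cnj (cinner x e) * cinner z e)" for z
    by (subst cinner_commute)
      (simp add: fourier_sum_def cinner_sum_left cinner_scaleC_left cinner_commute[of z])
  have 1: "cinner (x - fourier_sum F x) (fourier_sum F x) = 0"
    unfolding sum_right using cinner_diff_fourier_sum[OF F] by simp
  have 2: "cinner x (fourier_sum F x) = of_real (\<Sum>e\<in>F. (cmod (cinner x e))\<^sup>2)"
    unfolding sum_right of_real_sum
    by (intro sum.cong) (simp_all only: complex_norm_square mult.commute)
  have 3: "cinner (fourier_sum F x) x = of_real (\<Sum>e\<in>F. (cmod (cinner x e))\<^sup>2)"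
    by (subst cinner_commute) (simp only: 2 complex_cnj_complex_of_real)
  have "(norm (x - fourier_sum F x))\<^sup>2 = Re (cinner (x - fourier_sum F x) x)"
    by (simp add: power2_norm_eq_inner inner_eq_Re_cinner cinner_diff_right 1)
  also have "\<dots> = (norm x)\<^sup>2 - (\<Sum>e\<in>F. (cmod (cinner x e))\<^sup>2)"
    by (simp add: cinner_diff_left 3 cinner_same)
  finally show ?thesis .
qed

lemma subspace_closure:
  fixes S :: "'b::real_normed_vector set"
  assumes "subspace S"
  shows "subspace (closure S)"
  unfolding subspace_def
proof (intro conjI ballI allI)
  show "0 \<in> closure S" using assms subspace_0 closure_subset by blast
  fix x assume "x \<in> closure S"
  then obtain f where f: "\<And>n. f n \<in> S" "f \<longlonglongrightarrow> x" by (auto simp: closure_sequential)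
  show "r *\<^sub>R x \<in> closure S" for r
    unfolding closure_sequential using assms f
    by (intro exI[of _ "\<lambda>n. r *\<^sub>R f n"]) (auto intro!: tendsto_intros subspace_scale)
  fix y assume "y \<in> closure S"
  then obtain g where g: "\<And>n. g n \<in> S" "g \<longlonglongrightarrow> y" by (auto simp: closure_sequential)
  show "x + y \<in> closure S"
    unfolding closure_sequential using assms f g
    by (intro exI[of _ "\<lambda>n. f n + g n"]) (auto intro!: tendsto_intros subspace_add)
qed

text \<open>A nonzero vector orthogonal to the closed span could be normalized and added to
  \<open>E\<close>, against maximality. As \<open>span\<close> is real, the multiples by
  \<open>\<i>\<close> have to be adjoined to obtain the complex span.\<close>

lemma orthonormal_basis_dense:
  assumes E: "orthonormal_basis E"
  shows "closure (span (E \<union> (\<lambda>e. \<i> *\<^sub>C e) ` E)) = UNIV"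
proof (intro set_eqI iffI UNIV_I)
  fix x
  define M where "M = closure (span (E \<union> (\<lambda>e. \<i> *\<^sub>C e) ` E))"
  have sub: "E \<union> (\<lambda>e. \<i> *\<^sub>C e) ` E \<subseteq> M"
    unfolding M_def by (rule order_trans[OF span_superset closure_subset])
  have "subspace M" "closed M" by (auto simp: M_def subspace_closure)
  then obtain m where m: "m \<in> M" "\<And>y. y \<in> M \<Longrightarrow> inner (x - m) y = 0"
    using subspace_orthogonal_projection by blast
  define w where "w = x - m"
  have orth: "cinner w e = 0" if "e \<in> E" for e
    using that m(2)[of e] m(2)[of "\<i> *\<^sub>C e"] sub
    by (intro complex_eqI) (auto simp: Im_cinner w_def simp flip: inner_eq_Re_cinner)
  have "w = 0"
  proof (rule ccontr)
    assume w: "w \<noteq> 0"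
    define u where "u = (1 / norm w) *\<^sub>R w"
    have u: "cinner u e = 0" "cinner e u = 0" if "e \<in> E" for e
      using orth[OF that] cinner_commute[of e w]
      by (simp_all add: u_def cinner_scaleR_left cinner_scaleR_right)
    have uu: "cinner u u = 1" using w by (simp add: u_def cinner_same)
    have "orthonormal_set E" using E by (simp add: orthonormal_basis_def)
    then have "orthonormal_set (insert u E)"
      using u uu by (auto simp: orthonormal_set_def)
    then have "insert u E = E" using E unfolding orthonormal_basis_def by blast
    then have "u \<in> E" by blast
    then show False using u uu by simp
  qed
  then show "x \<in> closure (span (E \<union> (\<lambda>e. \<i> *\<^sub>C e) ` E))"
    using m by (simp add: w_def M_def)
qed

text \<open>Bessel's inequality bounds every finite partial sum; density of the span shows that
  these sums come arbitrarily close to the bound.\<close>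

lemma parseval:
  assumes E: "orthonormal_basis E"
  shows "(\<Sum>\<^sub>\<infinity>e\<in>E. ennreal ((cmod (cinner x e))\<^sup>2)) = ennreal ((norm x)\<^sup>2)"
proof -
  define g where "g e = (cmod (cinner x e))\<^sup>2" for e
  have onE: "orthonormal_set F" if "F \<subseteq> E" for F
    using E that unfolding orthonormal_basis_def orthonormal_set_def by blast
  have bessel: "sum g F \<le> (norm x)\<^sup>2" if "finite F" "F \<subseteq> E" for F
    using norm_diff_fourier_sum[OF onE[OF that(2)] that(1), of x] zero_le_power2
    unfolding g_def by (metis diff_ge_0_iff_ge)
  have approx: "\<exists>F. finite F \<and> F \<subseteq> E \<and> (norm x)\<^sup>2 \<le> sum g F + \<epsilon>" if \<epsilon>: "\<epsilon> > 0" for \<epsilon>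
  proof -
    have "x \<in> closure (span (E \<union> (\<lambda>e. \<i> *\<^sub>C e) ` E))" using orthonormal_basis_dense[OF E] by simp
    then obtain v where v: "v \<in> span (E \<union> (\<lambda>e. \<i> *\<^sub>C e) ` E)" "dist v x < sqrt \<epsilon>"
      using \<epsilon> unfolding closure_approachable by (meson real_sqrt_gt_zero)
    from v(1) obtain t r where t: "finite t" "t \<subseteq> E \<union> (\<lambda>e. \<i> *\<^sub>C e) ` E" "v = (\<Sum>a\<in>t. r a *\<^sub>R a)"
      unfolding span_explicit by blast
    \<comment> \<open>Collects the basis vectors that enter \<open>v\<close> through their multiples
      by \<open>\<i>\<close>, so that \<open>v\<close> lies in the complex span of the finite set
      \<open>F\<close>.\<close>
    obtain F' where F': "F' \<subseteq> E" "finite F'" "t - E = (\<lambda>e. \<i> *\<^sub>C e) ` F'"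
      using finite_subset_image[of "t - E" "\<lambda>e. \<i> *\<^sub>C e" E] t by blast
    define F where "F = (t \<inter> E) \<union> F'"
    have F: "finite F" "F \<subseteq> E" using t F' by (auto simp: F_def)
    have tF: "t \<subseteq> F \<union> (\<lambda>e. \<i> *\<^sub>C e) ` F" using t F' by (auto simp: F_def)
    define w where "w = x - fourier_sum F x"
    have we: "cinner w e = 0" if "e \<in> F" for e
      unfolding w_def by (rule cinner_diff_fourier_sum[OF onE[OF F(2)] F(1) that])
    have "inner w a = 0" if "a \<in> t" for a
      using that tF we by (auto simp: inner_eq_Re_cinner cinner_scaleC_right)
    then have "inner w v = 0" by (simp add: t inner_sum_right)
    moreover have "inner w (fourier_sum F x) = 0"
      unfolding fourier_sum_def inner_sum_right
      using we by (intro sum.neutral) (simp add: inner_eq_Re_cinner cinner_scaleC_right)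
    \<comment> \<open>The Fourier sum is a best approximation from the span of \<open>F\<close>: the
      residual \<open>w\<close> is no longer than \<open>x - v\<close>.\<close>
    ultimately have "inner w w = inner w (x - v)"
      by (simp add: w_def inner_diff_right)
    also have "\<dots> \<le> norm w * norm (x - v)" by (rule norm_cauchy_schwarz)
    finally have "norm w * norm w \<le> norm w * norm (x - v)" by (simp add: dot_square_norm power2_eq_square)
    then have "norm w \<le> norm (x - v)" by (cases "norm w = 0") auto
    also have "\<dots> < sqrt \<epsilon>" using v(2) by (simp add: dist_norm norm_minus_commute)
    finally have "(norm w)\<^sup>2 \<le> (sqrt \<epsilon>)\<^sup>2" by (intro power_mono) auto
    then have "(norm x)\<^sup>2 \<le> sum g F + \<epsilon>"
      using norm_diff_fourier_sum[OF onE[OF F(2)] F(1), of x] \<epsilon> unfolding g_def w_def by simp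
    then show ?thesis using F by blast
  qed
  have "(\<Sum>\<^sub>\<infinity>e\<in>E. ennreal (g e)) = (SUP F\<in>{F. finite F \<and> F \<subseteq> E}. \<Sum>e\<in>F. ennreal (g e))"
    by (rule nonneg_infsum_complete) simp
  also have "\<dots> = ennreal ((norm x)\<^sup>2)"
  proof (rule antisym)
    show "(SUP F\<in>{F. finite F \<and> F \<subseteq> E}. \<Sum>e\<in>F. ennreal (g e)) \<le> ennreal ((norm x)\<^sup>2)"
      using bessel by (intro SUP_least) (simp add: sum_ennreal g_def ennreal_leI)
    show "ennreal ((norm x)\<^sup>2) \<le> (SUP F\<in>{F. finite F \<and> F \<subseteq> E}. \<Sum>e\<in>F. ennreal (g e))"
    proof (rule ennreal_le_epsilon)
      fix \<epsilon> :: real assume "\<epsilon> > 0"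
      then obtain F where F: "finite F" "F \<subseteq> E" "(norm x)\<^sup>2 \<le> sum g F + \<epsilon>" using approx by blast
      have "ennreal ((norm x)\<^sup>2) \<le> ennreal (sum g F + \<epsilon>)" using F by (intro ennreal_leI)
      also have "\<dots> = (\<Sum>e\<in>F. ennreal (g e)) + ennreal \<epsilon>"
        using \<open>\<epsilon> > 0\<close> by (simp add: sum_ennreal ennreal_plus sum_nonneg g_def)
      also have "\<dots> \<le> (SUP F\<in>{F. finite F \<and> F \<subseteq> E}. \<Sum>e\<in>F. ennreal (g e)) + ennreal \<epsilon>"
        using F by (intro add_right_mono SUP_upper) auto
      finally show "ennreal ((norm x)\<^sup>2)
        \<le> (SUP F\<in>{F. finite F \<and> F \<subseteq> E}. \<Sum>e\<in>F. ennreal (g e)) + ennreal \<epsilon>" .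
    qed
  qed
  finally show ?thesis by (simp add: g_def)
qed

section \<open>Linearity of the trace on positive operators, rank-one operators and the norm
  bound\<close>

lemma infsum_cmult_ennreal:
  fixes f :: "'b \<Rightarrow> ennreal"
  shows "(\<Sum>\<^sub>\<infinity>x\<in>A. c * f x) = c * (\<Sum>\<^sub>\<infinity>x\<in>A. f x)"
  by (simp add: nonneg_infsum_complete SUP_mult_left_ennreal sum_distrib_left)

abbreviation some_basis :: "'a::chilbert_space set" where
  "some_basis \<equiv> SOME E. orthonormal_basis E"

lemma orthonormal_some_basis: "orthonormal_basis (some_basis :: 'a::chilbert_space set)"
  using orthonormal_basis_exists by (rule someI_ex)

lemma positive_operator_inner_nonneg: "positive_operator b \<Longrightarrow> 0 \<le> Re (cinner (b x) x)"
  by (simp add: positive_operator_def complex_nonneg_Reals_iff)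

lemma positive_operator_scaleR:
  "positive_operator b \<Longrightarrow> 0 \<le> r \<Longrightarrow> positive_operator (r *\<^sub>R b)"
  by (simp add: positive_operator_def bounded_operators_scaleR blinfun.scaleR_left
      cinner_scaleR_left complex_nonneg_Reals_iff)

lemma pos_trace_scaleR:
  assumes "positive_operator b" "k \<ge> 0"
  shows "pos_trace (k *\<^sub>R b) = ennreal k * pos_trace b"
  using assms positive_operator_inner_nonneg[OF assms(1)]
  by (simp add: pos_trace_def blinfun.scaleR_left cinner_scaleR_left ennreal_mult infsum_cmult_ennreal)

lemma pos_trace_add:
  assumes "positive_operator b" "positive_operator d"
  shows "pos_trace (b + d) = pos_trace b + pos_trace d"
  using positive_operator_inner_nonneg[OF assms(1)] positive_operator_inner_nonneg[OF assms(2)]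
  by (simp add: pos_trace_def blinfun.add_left cinner_add_left ennreal_plus
      infsum_add nonneg_summable_on_complete)

text \<open>For unit vectors this is a partial isometry taking \<xi> to \<eta>, and for \<eta> =
  \<xi> the projection onto the line through \<xi>.\<close>

lift_definition rank_one :: "'a::chilbert_space \<Rightarrow> 'a \<Rightarrow> 'a \<Rightarrow>\<^sub>L 'a" is "\<lambda>\<eta> \<xi> x. cinner x \<xi> *\<^sub>C \<eta>"
  by (rule bounded_linear_compose[OF bounded_linear_scaleC_left bounded_linear_cinner_left])

lemma rank_one_bounded_operator: "rank_one \<eta> \<xi> \<in> bounded_operators"
  by (simp add: bounded_operators_def rank_one.rep_eq cinner_scaleC_left scaleC_scaleC)

lemma cinner_rank_one_same: "cinner (rank_one \<xi> \<xi> x) x = of_real ((cmod (cinner x \<xi>))\<^sup>2)"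
  by (simp only: rank_one.rep_eq cinner_scaleC_left complex_norm_square cinner_commute[of \<xi> x])

lemma positive_rank_one: "positive_operator (rank_one \<xi> \<xi>)"
  by (simp add: positive_operator_def rank_one_bounded_operator cinner_rank_one_same
      complex_nonneg_Reals_iff)

text \<open>The diagonal entries are the squared moduli of the Fourier coefficients of \<xi>, so
  Parseval sums them.\<close>

lemma pos_trace_rank_one: "norm \<xi> = 1 \<Longrightarrow> pos_trace (rank_one \<xi> \<xi>) = 1"
  using parseval[OF orthonormal_some_basis, of \<xi>]
  by (simp add: pos_trace_def cinner_rank_one_same cinner_commute[of _ \<xi>])

text \<open>Hilbert--Schmidt bound: with \<open>p = d\<^sup>2\<close> the trace of \<open>p\<close> is the sum of the \<open>(norm (d e))\<^sup>2\<close>.\<close>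

lemma norm_positive_operator_le_trace:
  assumes p: "positive_operator p" and fin: "pos_trace p < \<infinity>"
  shows "norm p \<le> enn2real (pos_trace p)"
proof -
  define \<tau> where "\<tau> = enn2real (pos_trace p)"
  have \<tau>: "\<tau> \<ge> 0" "pos_trace p = ennreal \<tau>" using fin by (simp_all add: \<tau>_def)
  obtain d where d: "positive_operator d" "d o\<^sub>L d = p" using positive_operator_sqrt_exists[OF p] .
  note sym = positive_operator_cinner_commute[OF d(1)]
  have pe: "Re (cinner (p e) e) = (norm (d e))\<^sup>2" for e
    using sym[of "d e" e] by (simp add: d(2)[symmetric] cinner_same)
  \<comment> \<open>Parseval for \<open>d y\<close>, whose coefficients
    \<open>cinner y (d e)\<close> are estimated by Cauchy-Schwarz.\<close>
  have bound: "(norm (d y))\<^sup>2 \<le> \<tau> * (norm y)\<^sup>2" for y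
  proof -
    have "ennreal ((norm (d y))\<^sup>2) = (\<Sum>\<^sub>\<infinity>e\<in>some_basis. ennreal ((cmod (cinner y (d e)))\<^sup>2))"
      using parseval[OF orthonormal_some_basis, of "d y"] by (simp add: sym)
    also have "\<dots> \<le> (\<Sum>\<^sub>\<infinity>e\<in>some_basis. ennreal ((norm y)\<^sup>2) * ennreal ((norm (d e))\<^sup>2))"
    proof (rule infsum_mono)
      fix e
      have "(cmod (cinner y (d e)))\<^sup>2 \<le> (norm y * norm (d e))\<^sup>2"
        by (intro power_mono cinner_cauchy_schwarz) simp
      then show "ennreal ((cmod (cinner y (d e)))\<^sup>2) \<le> ennreal ((norm y)\<^sup>2) * ennreal ((norm (d e))\<^sup>2)"
        by (simp add: ennreal_leI power_mult_distrib flip: ennreal_mult)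
    qed (simp_all add: nonneg_summable_on_complete)
    also have "\<dots> = ennreal ((norm y)\<^sup>2) * pos_trace p"
      by (simp add: infsum_cmult_ennreal pos_trace_def pe)
    also have "\<dots> = ennreal (\<tau> * (norm y)\<^sup>2)" using \<tau> by (simp add: ennreal_mult mult.commute)
    finally show ?thesis using \<tau> by (simp add: ennreal_le_iff)
  qed
  show ?thesis unfolding \<tau>_def[symmetric]
  proof (rule norm_blinfun_bound[OF \<tau>(1)])
    fix y
    have "(norm (p y))\<^sup>2 \<le> \<tau> * (norm (d y))\<^sup>2" using bound[of "d y"] by (simp add: d(2)[symmetric])
    also have "\<dots> \<le> \<tau> * (\<tau> * (norm y)\<^sup>2)" by (intro mult_left_mono bound \<tau>)
    also have "\<dots> = (\<tau> * norm y)\<^sup>2" by (simp add: power2_eq_square)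
    finally show "norm (p y) \<le> \<tau> * norm y" using \<tau> by (simp add: power2_le_iff_abs_le)
  qed
qed

section \<open>Trace class operators and the extreme points of the unit ball\<close>

lemma compact_operatorI:
  assumes "a \<in> bounded_operators" "compact K" "\<And>x. norm x \<le> 1 \<Longrightarrow> blinfun_apply a x \<in> K"
  shows "compact_operator a"
proof -
  have "closure (a ` cball 0 1) \<subseteq> K"
    using assms by (intro closure_minimal compact_imp_closed) auto
  then have "K \<inter> closure (a ` cball 0 1) = closure (a ` cball 0 1)" by blast
  moreover have "compact (K \<inter> closure (a ` cball 0 1))" using assms by (intro compact_Int_closed) auto
  ultimately show ?thesis using assms by (simp add: compact_operator_def)
qed

lemma compact_operatorD:
  assumes "compact_operator a"
  shows compact_operator_bounded: "a \<in> bounded_operators"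
    and compact_operator_image: "compact (closure (a ` cball 0 1))"
  using assms by (auto simp: compact_operator_def)

lemma apply_mem_closure_image_cball:
  "norm x \<le> 1 \<Longrightarrow> blinfun_apply a x \<in> closure (a ` cball 0 1)"
  using closure_subset[of "a ` cball 0 1"] by auto

lemma compact_operator_0: "compact_operator 0"
  by (rule compact_operatorI[of _ "{0}"]) (simp_all add: bounded_operators_0)

lemma compact_operator_scaleR:
  assumes "compact_operator a"
  shows "compact_operator (r *\<^sub>R a)"
  by (rule compact_operatorI[OF _ compact_scaling[OF compact_operator_image[OF assms], of r]])
    (auto simp: bounded_operators_scaleR compact_operator_bounded[OF assms] blinfun.scaleR_left
      intro!: imageI apply_mem_closure_image_cball)

lemma compact_operator_add:
  assumes "compact_operator a" "compact_operator b"
  shows "compact_operator (a + b)"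
  by (rule compact_operatorI[OF _ compact_sums'[OF assms[THEN compact_operator_image]]])
    (auto simp: bounded_operators_add assms[THEN compact_operator_bounded] blinfun.add_left
      intro!: apply_mem_closure_image_cball)

lemma compact_operator_rank_one: "compact_operator (rank_one \<eta> \<xi>)"
proof (rule compact_operatorI[OF rank_one_bounded_operator])
  show "compact ((\<lambda>c. c *\<^sub>C \<eta>) ` cball 0 (norm \<xi>))"
    by (intro compact_continuous_image compact_cball
        linear_continuous_on bounded_linear_scaleC_left)
  fix x :: 'a assume "norm x \<le> 1"
  then have "cmod (cinner x \<xi>) \<le> norm \<xi>"
    using cinner_cauchy_schwarz[of x \<xi>] mult_right_mono[of "norm x" 1 "norm \<xi>"] by simp
  then show "rank_one \<eta> \<xi> x \<in> (\<lambda>c. c *\<^sub>C \<eta>) ` cball 0 (norm \<xi>)"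
    by (simp add: rank_one.rep_eq)
qed

text \<open>A maximizing sequence \<open>x\<close> of unit vectors is nearly an eigenvector sequence of \<open>a\<^sup>*a\<close> for
  the eigenvalue \<open>(norm a)\<^sup>2\<close>, so convergence of a subsequence of \<open>a x\<close> forces that of \<open>x\<close>.\<close>

lemma compact_operator_norm_attained:
  fixes a :: "'a::chilbert_space \<Rightarrow>\<^sub>L 'a"
  assumes a: "compact_operator a" and "a \<noteq> 0"
  obtains \<xi> where "norm \<xi> = 1" "norm (a \<xi>) = norm a"
proof -
  define s where "s = norm a"
  have s: "s > 0" using assms by (simp add: s_def)
  note aB = compact_operator_bounded[OF a]
  define b where "b = cadjoint a"
  have "\<exists>x. norm x = 1 \<and> s - s / real (Suc n) < norm (a x)" for n
  proof (rule ccontr)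
    define r where "r = s - s / real (Suc n)"
    assume *: "\<nexists>x. norm x = 1 \<and> s - s / real (Suc n) < norm (a x)"
    have r: "0 \<le> r" "r < s" using s by (auto simp: r_def field_simps)
    have "norm (a x) \<le> r * norm x" for x
    proof (cases "x = 0")
      case False
      have "norm ((1 / norm x) *\<^sub>R x) = 1" using False by simp
      then have "norm (a ((1 / norm x) *\<^sub>R x)) \<le> r" using * unfolding r_def by (metis not_le)
      then show ?thesis using False by (simp add: blinfun.scaleR_right field_simps)
    qed simp
    then have "norm a \<le> r" using r by (intro norm_blinfun_bound)
    then show False using r by (simp add: s_def)
  qed
  then obtain x where x: "\<And>n. norm (x n) = 1" "\<And>n. s - s / real (Suc n) < norm (a (x n))" by metis
  have "\<forall>n. a (x n) \<in> closure (a ` cball 0 1)" using x by (simp add: apply_mem_closure_image_cball)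
  with compact_operator_image[OF a] obtain v q where q: "strict_mono q" "((\<lambda>n. a (x n)) \<circ> q) \<longlonglongrightarrow> v"
    unfolding compact_def by metis
  define y where "y n = x (q n)" for n
  have ay: "(\<lambda>n. a (y n)) \<longlonglongrightarrow> v" using q(2) by (simp add: y_def o_def)
  have "(\<lambda>n. norm (a (x n))) \<longlonglongrightarrow> s"
  proof (rule real_tendsto_sandwich)
    show "\<forall>\<^sub>F n in sequentially. s - s / real (Suc n) \<le> norm (a (x n))"
      using x(2) by (intro always_eventually allI less_imp_le)
    show "\<forall>\<^sub>F n in sequentially. norm (a (x n)) \<le> s"
      using norm_blinfun[of a] x(1) by (intro always_eventually allI) (metis mult.right_neutral s_def)
    have "(\<lambda>n. s - s * inverse (real (Suc n))) \<longlonglongrightarrow> s - s * 0"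
      by (intro tendsto_intros LIMSEQ_inverse_real_of_nat)
    then show "(\<lambda>n. s - s / real (Suc n)) \<longlonglongrightarrow> s" by (simp add: divide_inverse)
  qed auto
  from LIMSEQ_subseq_LIMSEQ[OF this q(1)] have nay: "(\<lambda>n. norm (a (y n))) \<longlonglongrightarrow> s"
    by (simp add: y_def o_def)
  have nv: "norm v = s" using LIMSEQ_unique[OF tendsto_norm[OF ay] nay] .
  define z where "z n = b (a (y n)) - s\<^sup>2 *\<^sub>R y n" for n
  \<comment> \<open>Expanding the square, the leading term is at most \<open>(s * s)\<^sup>2\<close>
    and the inner product in the cross term equals \<open>(norm (a (y n)))\<^sup>2\<close>.\<close>
  have z: "(norm (z n))\<^sup>2 \<le> 2 * s\<^sup>2 * (s\<^sup>2 - (norm (a (y n)))\<^sup>2)" for n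
  proof -
    have "inner (b (a (y n))) (y n) = (norm (a (y n)))\<^sup>2"
      by (subst inner_commute) (simp add: b_def power2_norm_eq_inner flip: inner_cadjoint[OF aB])
    moreover have "(norm (z n))\<^sup>2
        = (norm (b (a (y n))))\<^sup>2 - 2 * s\<^sup>2 * inner (b (a (y n))) (y n) + s\<^sup>2 * s\<^sup>2 * (norm (y n))\<^sup>2"
      unfolding z_def power2_norm_eq_inner by (simp add: algebra_simps inner_commute)
    moreover have "(norm (b (a (y n))))\<^sup>2 \<le> (s * norm (a (y n)))\<^sup>2"
      unfolding b_def s_def by (intro power_mono norm_cadjoint_apply_le aB) simp
    moreover have "(norm (y n))\<^sup>2 = 1" using x(1) by (simp add: y_def)
    moreover have "(s * norm (a (y n)))\<^sup>2 \<le> (s * s)\<^sup>2"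
      using norm_blinfun[of a "y n"] x(1) s
      by (intro power_mono mult_left_mono) (auto simp: y_def s_def)
    ultimately show ?thesis by (simp add: algebra_simps power2_eq_square)
  qed
  have z0: "z \<longlonglongrightarrow> 0"
  proof -
    have "(\<lambda>n. sqrt (2 * s\<^sup>2 * (s\<^sup>2 - (norm (a (y n)))\<^sup>2))) \<longlonglongrightarrow> sqrt (2 * s\<^sup>2 * (s\<^sup>2 - s\<^sup>2))"
      by (intro tendsto_intros nay)
    moreover have "norm (z n) \<le> sqrt (2 * s\<^sup>2 * (s\<^sup>2 - (norm (a (y n)))\<^sup>2))" for n
      using z by (intro real_le_rsqrt)
    ultimately show ?thesis
      by (intro Lim_null_comparison[of z]) (auto intro: always_eventually)
  qed
  have bv: "(\<lambda>n. b (a (y n))) \<longlonglongrightarrow> b v" by (intro tendsto_intros ay)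
  \<comment> \<open>Solving the definition of \<open>z\<close> for \<open>y n\<close> expresses it
    through two convergent sequences.\<close>
  have "(\<lambda>n. (1 / s\<^sup>2) *\<^sub>R (b (a (y n)) - z n)) \<longlonglongrightarrow> (1 / s\<^sup>2) *\<^sub>R (b v - 0)"
    by (rule tendsto_scaleR[OF tendsto_const tendsto_diff[OF bv z0]])
  moreover have "(1 / s\<^sup>2) *\<^sub>R (b (a (y n)) - z n) = y n" for n
    using s by (simp add: z_def)
  ultimately have y: "y \<longlonglongrightarrow> (1 / s\<^sup>2) *\<^sub>R b v" by simp
  define \<xi> where "\<xi> = (1 / s\<^sup>2) *\<^sub>R b v"
  have y\<xi>: "y \<longlonglongrightarrow> \<xi>" using y by (simp add: \<xi>_def)
  show ?thesis
  proof
    have "(\<lambda>n. norm (y n)) \<longlonglongrightarrow> norm \<xi>" by (intro tendsto_intros y\<xi>)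
    then show "norm \<xi> = 1" using x(1) by (simp add: y_def LIMSEQ_const_iff)
    have "(\<lambda>n. a (y n)) \<longlonglongrightarrow> a \<xi>" by (intro tendsto_intros y\<xi>)
    then show "norm (a \<xi>) = norm a" using LIMSEQ_unique[OF ay] nv by (simp add: s_def)
  qed
qed

text \<open>A unit vector at which \<open>a\<close> attains its norm is a singular vector of \<open>a\<close>, i.e.
  \<open>a\<^sup>* \<eta> = norm a * \<xi>\<close>.\<close>

lemma cinner_apply_norming:
  assumes a: "a \<in> bounded_operators" and "norm \<xi> = 1" "norm \<eta> = 1" "a \<xi> = norm a *\<^sub>R \<eta>"
  shows "cinner (a x) \<eta> = of_real (norm a) * cinner x \<xi>"
proof -
  define s where "s = norm a"
  define w where "w = cadjoint a \<eta>"
  have "norm w \<le> s" unfolding w_def s_def using norm_cadjoint_apply_le[OF a, of \<eta>] assms by simp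
  then have "(norm w)\<^sup>2 \<le> s\<^sup>2" by (intro power_mono) auto
  moreover have "inner \<xi> w = s"
    using assms by (simp add: w_def s_def dot_square_norm flip: inner_cadjoint[OF a])
  \<comment> \<open>Equality case of Cauchy-Schwarz: \<open>w\<close> has norm at most
    \<open>s\<close> and inner product \<open>s\<close> with the unit vector \<xi>.\<close>
  moreover have "(norm (w - s *\<^sub>R \<xi>))\<^sup>2 = (norm w)\<^sup>2 - 2 * s * inner \<xi> w + s\<^sup>2 * (norm \<xi>)\<^sup>2"
    unfolding power2_norm_eq_inner by (simp add: algebra_simps inner_commute power2_eq_square)
  ultimately have "(norm (w - s *\<^sub>R \<xi>))\<^sup>2 \<le> 0" using assms by (simp add: power2_eq_square)
  then have "cadjoint a \<eta> = norm a *\<^sub>R \<xi>" by (simp add: w_def s_def)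
  then show ?thesis by (simp add: cinner_cadjoint[OF a] cinner_scaleR_right)
qed

text \<open>The inequality \<open>psd_norm_apply_le\<close> makes
  \<open>norm c * inner (c \<xi>) \<xi>\<close> at least \<open>(norm c)\<^sup>2\<close>, so the
  squared distance between the two sides is at most 0.\<close>

lemma psd_norming_eigenvector:
  assumes c: "psd c" and "norm \<xi> = 1" "norm (c \<xi>) = norm c"
  shows "c \<xi> = norm c *\<^sub>R \<xi>"
proof -
  have "(norm (c \<xi> - norm c *\<^sub>R \<xi>))\<^sup>2 = (norm (c \<xi>))\<^sup>2 - 2 * norm c * inner (c \<xi>) \<xi> + (norm c)\<^sup>2 * (norm \<xi>)\<^sup>2"
    unfolding power2_norm_eq_inner by (simp add: algebra_simps inner_commute power2_eq_square)
  also have "\<dots> \<le> 0"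
    using psd_norm_apply_le[OF c order_refl, of \<xi>] assms by (simp add: power2_eq_square)
  finally show ?thesis by simp
qed

text \<open>Expand the square; the second hypothesis evaluates the cross term. The result depends on
  \<open>k\<close> only through \<open>(s + k)\<^sup>2\<close>, so it cannot distinguish
  \<open>s + k\<close> from its absolute value.\<close>

lemma norm_add_rank_one_apply:
  fixes a :: "'a::chilbert_space \<Rightarrow>\<^sub>L 'a"
  assumes "norm \<eta> = 1" "cinner (a x) \<eta> = of_real s * cinner x \<xi>"
  shows "(norm ((a + k *\<^sub>R rank_one \<eta> \<xi>) x))\<^sup>2
    = (norm (a x))\<^sup>2 + ((s + k)\<^sup>2 - s\<^sup>2) * (cmod (cinner x \<xi>))\<^sup>2"
proof -
  define w where "w = cinner x \<xi> *\<^sub>C \<eta>"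
  have "cinner (a x) w = of_real (s * (cmod (cinner x \<xi>))\<^sup>2)"
    using assms(2) by (simp only: w_def cinner_scaleC_right of_real_mult complex_norm_square)
      (simp add: algebra_simps)
  then have "inner (a x) w = s * (cmod (cinner x \<xi>))\<^sup>2"
    by (simp add: inner_eq_Re_cinner)
  moreover have "norm w = cmod (cinner x \<xi>)" using assms(1) by (simp add: w_def norm_scaleC)
  moreover have "(norm (a x + k *\<^sub>R w))\<^sup>2 = (norm (a x))\<^sup>2 + 2 * k * inner (a x) w + k\<^sup>2 * (norm w)\<^sup>2"
    unfolding power2_norm_eq_inner by (simp add: algebra_simps inner_commute power2_eq_square)
  ultimately show ?thesis
    by (simp add: blinfun.add_left blinfun.scaleR_left rank_one.rep_eq w_def[symmetric]
        power2_eq_square algebra_simps)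
qed

section \<open>The trace norm and its change under rank-one perturbations\<close>

lemma trace_classD:
  assumes "a \<in> trace_class"
  shows trace_class_bounded_operator: "a \<in> bounded_operators"
    and trace_class_compact: "compact_operator a"
    and pos_trace_abs_operator: "pos_trace (abs_operator a) = ennreal (trace_norm a)"
  using assms by (auto simp: trace_class_def compact_operator_def trace_norm_def)

lemma trace_norm_nonneg: "0 \<le> trace_norm a"
  by (simp add: trace_norm_def)

lemma norm_abs_operator: "a \<in> bounded_operators \<Longrightarrow> norm (abs_operator a) = norm a"
  by (simp add: norm_blinfun.rep_eq onorm_def norm_abs_operator_apply)

text \<open>The trace bound for positive operators, applied to the absolute value. Later it makes
  ball elements contractions and operators of trace norm 0 vanish.\<close>

lemma norm_le_trace_norm: "a \<in> trace_class \<Longrightarrow> norm a \<le> trace_norm a"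
  using norm_positive_operator_le_trace[OF positive_abs_operator, of a]
    norm_abs_operator[of a] trace_class_bounded_operator[of a]
  by (simp add: trace_norm_def trace_class_def)

lemma trace_class_0: "(0 :: 'a::chilbert_space \<Rightarrow>\<^sub>L 'a) \<in> trace_class"
  and trace_norm_0: "trace_norm (0 :: 'a \<Rightarrow>\<^sub>L 'a) = 0"
proof -
  have "abs_operator (0 :: 'a \<Rightarrow>\<^sub>L 'a) = 0"
    by (simp add: abs_operator_iff bounded_operators_0 positive_operator_iff psd_def)
  then show "(0 :: 'a \<Rightarrow>\<^sub>L 'a) \<in> trace_class" "trace_norm (0 :: 'a \<Rightarrow>\<^sub>L 'a) = 0"
    by (simp_all add: trace_class_def trace_norm_def compact_operator_0 pos_trace_def cinner_zero_left)
qed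

lemma
  assumes a: "a \<in> trace_class" and r: "0 \<le> r"
  shows trace_class_scaleR: "r *\<^sub>R a \<in> trace_class"
    and trace_norm_scaleR: "trace_norm (r *\<^sub>R a) = r * trace_norm a"
proof -
  note aB = trace_class_bounded_operator[OF a]
  have "abs_operator (r *\<^sub>R a) = r *\<^sub>R abs_operator a"
    using positive_abs_operator[OF aB] r
    by (simp add: abs_operator_iff bounded_operators_scaleR aB positive_operator_scaleR
        blinfun.scaleR_left norm_abs_operator_apply)
  then have "pos_trace (abs_operator (r *\<^sub>R a)) = ennreal (r * trace_norm a)"
    using positive_abs_operator[OF aB] r
    by (simp add: pos_trace_scaleR pos_trace_abs_operator[OF a] ennreal_mult trace_norm_nonneg)
  then show "r *\<^sub>R a \<in> trace_class" "trace_norm (r *\<^sub>R a) = r * trace_norm a"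
    using r trace_class_compact[OF a]
    by (simp_all add: trace_class_def trace_norm_def compact_operator_scaleR)
qed

text \<open>The candidate \<open>c'\<close> for the absolute value is positive and has images of the
  right norm, which identifies it; its trace then gives both claims.\<close>

lemma
  assumes a: "a \<in> trace_class" and \<xi>: "norm \<xi> = 1" and \<eta>: "norm \<eta> = 1" and "a \<xi> = norm a *\<^sub>R \<eta>"
  shows trace_class_add_rank_one: "a + k *\<^sub>R rank_one \<eta> \<xi> \<in> trace_class"
    and trace_norm_add_rank_one:
      "trace_norm (a + k *\<^sub>R rank_one \<eta> \<xi>) = trace_norm a - norm a + \<bar>norm a + k\<bar>"
proof -
  note aB = trace_class_bounded_operator[OF a]
  define s where "s = norm a"
  define c where "c = abs_operator a"
  define r where "r = \<bar>s + k\<bar>"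
  define c' where "c' = c + (r - s) *\<^sub>R rank_one \<xi> \<xi>"
  have s: "s \<ge> 0" by (simp add: s_def)
  have c: "positive_operator c" "psd c" "c \<in> bounded_operators" and normc: "norm c = s"
    and nc: "\<And>x. norm (c x) = norm (a x)"
    using positive_abs_operator[OF aB]
    by (auto simp: c_def positive_operator_iff norm_abs_operator_apply norm_abs_operator aB s_def)
  have "norm (c \<xi>) = norm c" using assms by (simp add: nc normc s_def)
  then have "c \<xi> = norm c *\<^sub>R \<xi>" by (rule psd_norming_eigenvector[OF c(2) \<xi>])
  then have c\<xi>: "cinner (c x) \<xi> = of_real s * cinner x \<xi>" for x
    using cinner_apply_norming[OF c(3) \<xi> \<xi>] normc by simp
  have a\<eta>: "cinner (a x) \<eta> = of_real s * cinner x \<xi>" for x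
    unfolding s_def by (rule cinner_apply_norming[OF aB]) (use assms in auto)
  \<comment> \<open>The part of \<open>c\<close> along its eigenvector lies below \<open>c\<close>.
    This keeps \<open>c'\<close> positive when \<open>r - s\<close> is negative.\<close>
  have le: "s * (cmod (cinner x \<xi>))\<^sup>2 \<le> inner (c x) x" for x
  proof (cases "s = 0")
    case True
    moreover have "0 \<le> inner (c x) x" using c(2) unfolding psd_def by blast
    ultimately show ?thesis by simp
  next
    case False
    have "s * cmod (cinner x \<xi>) = cmod (cinner (c x) \<xi>)" using s by (simp add: c\<xi> norm_mult)
    also have "\<dots> \<le> norm (c x)" using cinner_cauchy_schwarz[of "c x" \<xi>] \<xi> by simp
    finally have "(s * cmod (cinner x \<xi>))\<^sup>2 \<le> (norm (c x))\<^sup>2" using s by (intro power_mono) auto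
    also have "\<dots> \<le> s * inner (c x) x" using psd_norm_apply_le[OF c(2)] normc by simp
    finally have "s * (s * (cmod (cinner x \<xi>))\<^sup>2) \<le> s * inner (c x) x"
      by (simp add: power2_eq_square mult_ac)
    then show ?thesis using False s by simp
  qed
  have c'_inner: "inner (c' x) x = inner (c x) x + (r - s) * (cmod (cinner x \<xi>))\<^sup>2" for x
    by (simp add: c'_def blinfun.add_left blinfun.scaleR_left inner_add_left)
      (simp add: inner_eq_Re_cinner cinner_rank_one_same)
  have "positive_operator c'"
  proof -
    have "psd (rank_one \<xi> \<xi>)" using positive_rank_one positive_operator_iff by blast
    then have "inner (c' x) y = inner x (c' y)" for x y
      using c(2) by (simp add: psd_def c'_def blinfun.add_left blinfun.scaleR_left inner_add_left inner_add_right)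
    moreover have "0 \<le> inner (c' x) x" for x
    proof -
      have "0 \<le> r * (cmod (cinner x \<xi>))\<^sup>2" by (simp add: r_def)
      then show ?thesis using le[of x] by (simp add: c'_inner algebra_simps)
    qed
    ultimately show ?thesis
      by (simp add: positive_operator_iff psd_def c'_def c(3) bounded_operators_add
          bounded_operators_scaleR rank_one_bounded_operator)
  qed
  moreover have "norm (c' x) = norm ((a + k *\<^sub>R rank_one \<eta> \<xi>) x)" for x
  proof -
    have "(norm (c' x))\<^sup>2 = (norm ((a + k *\<^sub>R rank_one \<eta> \<xi>) x))\<^sup>2"
      unfolding c'_def norm_add_rank_one_apply[OF \<xi> c\<xi>] norm_add_rank_one_apply[OF \<eta> a\<eta>]
      by (simp add: nc r_def)
    then show ?thesis by (simp add: power2_eq_iff_nonneg)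
  qed
  ultimately have abs: "abs_operator (a + k *\<^sub>R rank_one \<eta> \<xi>) = c'"
    by (simp add: abs_operator_iff aB bounded_operators_add bounded_operators_scaleR
          rank_one_bounded_operator)
  \<comment> \<open>Since \<open>r - s\<close> may be negative, the equation is rearranged so that
    additivity of the trace applies to positive summands on both sides.\<close>
  have "c' + s *\<^sub>R rank_one \<xi> \<xi> = c + r *\<^sub>R rank_one \<xi> \<xi>"
    by (simp add: c'_def algebra_simps)
  then have "pos_trace (c' + s *\<^sub>R rank_one \<xi> \<xi>) = pos_trace (c + r *\<^sub>R rank_one \<xi> \<xi>)" by simp
  moreover have scaled: "positive_operator (t *\<^sub>R rank_one \<xi> \<xi>)"
    "pos_trace (t *\<^sub>R rank_one \<xi> \<xi>) = ennreal t" if "t \<ge> 0" for t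
    using that positive_rank_one[of \<xi>]
    by (simp_all add: pos_trace_scaleR pos_trace_rank_one \<xi> positive_operator_scaleR)
  ultimately have "pos_trace c' + ennreal s = ennreal (trace_norm a) + ennreal r"
    using s c(1) \<open>positive_operator c'\<close>
    by (simp add: pos_trace_add r_def c_def pos_trace_abs_operator[OF a])
  then have eq: "pos_trace c' + ennreal s = ennreal (trace_norm a + r)"
    by (simp add: ennreal_plus trace_norm_nonneg r_def)
  then have fin: "pos_trace c' < \<infinity>"
    by (metis ennreal_add_eq_top ennreal_neq_top infinity_ennreal_def top.not_eq_extremum)
  then have "pos_trace c' = ennreal (enn2real (pos_trace c'))" by simp
  with eq have "ennreal (enn2real (pos_trace c') + s) = ennreal (trace_norm a + r)"
    using s by (metis enn2real_nonneg ennreal_plus)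
  then have "enn2real (pos_trace c') + s = trace_norm a + r"
    using s by (subst (asm) ennreal_inj) (auto simp: trace_norm_nonneg r_def)
  then show "trace_norm (a + k *\<^sub>R rank_one \<eta> \<xi>) = trace_norm a - norm a + \<bar>norm a + k\<bar>"
    by (simp add: trace_norm_def[of "a + _"] abs r_def s_def)
  show "a + k *\<^sub>R rank_one \<eta> \<xi> \<in> trace_class"
    using fin trace_class_compact[OF a]
    by (simp add: trace_class_def abs compact_operator_add compact_operator_scaleR
        compact_operator_rank_one)
qed

section \<open>Rank-one extreme points\<close>

lemma rank_one_mem_unit_ball:
  assumes "norm \<xi> = 1" "norm \<eta> = 1"
  shows "rank_one \<eta> \<xi> \<in> unit_ball trace_class trace_norm"
  using trace_class_add_rank_one[OF trace_class_0 assms, of 1]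
    trace_norm_add_rank_one[OF trace_class_0 assms, of 1]
  by (simp add: unit_ball_def trace_norm_0)

text \<open>The chain from 1 through \<open>inner (y \<xi>) \<eta>\<close>,
  \<open>norm (y \<xi>)\<close>, \<open>norm y\<close> and \<open>trace_norm y\<close> back to 1
  collapses to equalities. So \<open>y\<close> maps \<xi> to \<eta>, and the perturbation formula
  with \<open>k = -1\<close> annihilates the difference.\<close>

lemma eq_rank_one_if_norming:
  assumes y: "y \<in> unit_ball trace_class trace_norm" and \<xi>: "norm \<xi> = 1" and \<eta>: "norm \<eta> = 1"
    and "1 \<le> inner (y \<xi>) \<eta>"
  shows "y = rank_one \<eta> \<xi>"
proof -
  have yT: "y \<in> trace_class" "trace_norm y \<le> 1" using y by (auto simp: unit_ball_def)
  have "1 \<le> norm (y \<xi>) * norm \<eta>" using norm_cauchy_schwarz[of "y \<xi>" \<eta>] assms by linarith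
  moreover have "norm (y \<xi>) \<le> norm y * norm \<xi>" by (rule norm_blinfun)
  moreover have "norm y \<le> 1" using norm_le_trace_norm[OF yT(1)] yT(2) by simp
  ultimately have n: "norm y = 1" "norm (y \<xi>) = 1" using \<xi> \<eta> by auto
  have "(norm (y \<xi> - \<eta>))\<^sup>2 = (norm (y \<xi>))\<^sup>2 - 2 * inner (y \<xi>) \<eta> + (norm \<eta>)\<^sup>2"
    unfolding power2_norm_eq_inner by (simp add: algebra_simps inner_commute)
  also have "\<dots> \<le> 0" using assms n by simp
  finally have "y \<xi> = norm y *\<^sub>R \<eta>" using n by simp
  note rank_one = trace_class_add_rank_one[OF yT(1) \<xi> \<eta> this, of "-1"]
    trace_norm_add_rank_one[OF yT(1) \<xi> \<eta> this, of "-1"]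
  have "norm (y + (-1) *\<^sub>R rank_one \<eta> \<xi>) \<le> trace_norm (y + (-1) *\<^sub>R rank_one \<eta> \<xi>)"
    by (rule norm_le_trace_norm[OF rank_one(1)])
  also have "\<dots> \<le> 0" unfolding rank_one(2) using n yT(2) by simp
  finally show ?thesis by simp
qed

lemma extreme_point_rank_one:
  assumes \<xi>: "norm \<xi> = 1" and \<eta>: "norm \<eta> = 1"
  shows "rank_one \<eta> \<xi> extreme_point_of unit_ball trace_class trace_norm"
  unfolding extreme_point_of_def
proof (intro conjI ballI notI)
  show "rank_one \<eta> \<xi> \<in> unit_ball trace_class trace_norm"
    by (rule rank_one_mem_unit_ball[OF assms])
  fix y z :: "'a \<Rightarrow>\<^sub>L 'a"
  assume y: "y \<in> unit_ball trace_class trace_norm" and z: "z \<in> unit_ball trace_class trace_norm"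
    and "rank_one \<eta> \<xi> \<in> open_segment y z"
  then obtain u where u: "y \<noteq> z" "0 < u" "u < 1" "rank_one \<eta> \<xi> = (1 - u) *\<^sub>R y + u *\<^sub>R z"
    by (auto simp: in_segment)
  \<comment> \<open>This linear functional is bounded by 1 on the ball and equals 1 at the rank-one
    operator, so it must equal 1 at both ends of the segment.\<close>
  have le: "inner (v \<xi>) \<eta> \<le> 1" if "v \<in> unit_ball trace_class trace_norm" for v :: "'a \<Rightarrow>\<^sub>L 'a"
  proof -
    have "norm v \<le> 1" using that norm_le_trace_norm[of v] by (auto simp: unit_ball_def)
    then show ?thesis
      using norm_cauchy_schwarz[of "v \<xi>" \<eta>] norm_blinfun[of v \<xi>] assms by simp
  qed
  have "rank_one \<eta> \<xi> \<xi> = \<eta>"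
    using \<xi> scaleR_scaleC[of 1 \<eta>] by (simp add: rank_one.rep_eq cinner_same)
  then have "inner (rank_one \<eta> \<xi> \<xi>) \<eta> = 1" using \<eta> by (simp add: dot_square_norm)
  then have sum: "(1 - u) * inner (y \<xi>) \<eta> + u * inner (z \<xi>) \<eta> = 1"
    by (simp add: u(4) blinfun.add_left blinfun.scaleR_left inner_add_left)
  have "(1 - u) * inner (y \<xi>) \<eta> \<le> 1 - u" "u * inner (z \<xi>) \<eta> \<le> u"
    using mult_left_mono[OF le[OF y], of "1 - u"] mult_left_mono[OF le[OF z], of u] u by auto
  then have "(1 - u) * 1 \<le> (1 - u) * inner (y \<xi>) \<eta>" "u * 1 \<le> u * inner (z \<xi>) \<eta>"
    using sum by auto
  then have "1 \<le> inner (y \<xi>) \<eta>" "1 \<le> inner (z \<xi>) \<eta>" using u by simp_all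
  then have "y = rank_one \<eta> \<xi>" "z = rank_one \<eta> \<xi>"
    using eq_rank_one_if_norming[OF y \<xi> \<eta>] eq_rank_one_if_norming[OF z \<xi> \<eta>] by auto
  then show False using u(1) by simp
qed

section \<open>Amenable triplets and the lambda-function\<close>

lemma norming_pair_exists:
  fixes a :: "'a::chilbert_space \<Rightarrow>\<^sub>L 'a"
  assumes "compact_operator a" and "x \<noteq> (0 :: 'a)"
  obtains \<xi> \<eta> where "norm \<xi> = 1" "norm \<eta> = 1" "a \<xi> = norm a *\<^sub>R \<eta>"
proof (cases "a = 0")
  case True
  \<comment> \<open>For the zero operator any unit vectors will do; normalizing \<open>x\<close>
    supplies them.\<close>
  then show ?thesis
    using that[of "(1 / norm x) *\<^sub>R x" "(1 / norm x) *\<^sub>R x"] assms(2) by simp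
next
  case False
  then obtain \<xi> where "norm \<xi> = 1" "norm (a \<xi>) = norm a"
    using compact_operator_norm_attained[OF assms(1)] by blast
  then show ?thesis using that[of \<xi> "(1 / norm a) *\<^sub>R a \<xi>"] False by simp
qed

lemma amenable_triplet_exists:
  fixes a :: "'a::chilbert_space \<Rightarrow>\<^sub>L 'a"
  assumes a: "a \<in> unit_ball trace_class trace_norm"
  obtains e y t where "amenable trace_class trace_norm a e y t"
    "(1 - trace_norm a + 2 * norm a) / 2 \<le> t"
proof (cases "\<exists>x :: 'a. x \<noteq> 0")
  \<comment> \<open>The zero space has no unit vectors. Its ball is the single point 0, which is
    extreme, and the weight 1 is attained.\<close>
  case False
  then have all0: "v = 0" for v :: "'a \<Rightarrow>\<^sub>L 'a" by (intro blinfun_eqI) simp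
  have "0 \<in> unit_ball trace_class (trace_norm :: ('a \<Rightarrow>\<^sub>L 'a) \<Rightarrow> real)"
    by (simp add: unit_ball_def trace_class_0 trace_norm_0)
  moreover have "0 extreme_point_of unit_ball trace_class (trace_norm :: ('a \<Rightarrow>\<^sub>L 'a) \<Rightarrow> real)"
    unfolding extreme_point_of_def using calculation all0
    by (metis open_segment_idem empty_iff)
  ultimately have "amenable trace_class trace_norm a 0 0 1"
    by (simp add: amenable_def all0[of a])
  then show ?thesis using that by (simp add: all0[of a] trace_norm_0)
next
  case True
  have aT: "a \<in> trace_class" "trace_norm a \<le> 1" using a by (auto simp: unit_ball_def)
  obtain \<xi> \<eta> where \<xi>: "norm \<xi> = 1" and \<eta>: "norm \<eta> = 1" and "a \<xi> = norm a *\<^sub>R \<eta>"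
    using norming_pair_exists[OF trace_class_compact[OF aT(1)]] True by blast
  note sub = trace_class_add_rank_one[OF aT(1) this] trace_norm_add_rank_one[OF aT(1) this]
  define t where "t = (1 - trace_norm a + 2 * norm a) / 2"
  define e where "e = rank_one \<eta> \<xi>"
  note e = extreme_point_rank_one[OF \<xi> \<eta>, folded e_def]
    and eball = rank_one_mem_unit_ball[OF \<xi> \<eta>, folded e_def]
  have t: "0 \<le> t" "t \<le> 1"
    using aT(2) norm_le_trace_norm[OF aT(1)] by (simp_all add: t_def add_nonneg_nonneg)
  define d where "d = a + (- t) *\<^sub>R e"
  have d: "d \<in> trace_class" using sub(1)[of "- t"] by (simp only: d_def e_def)
  have "trace_norm d = trace_norm a - norm a + \<bar>norm a + (- t)\<bar>"
    using sub(2)[of "- t"] by (simp only: d_def e_def)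
  \<comment> \<open>Here \<open>t\<close> is at least \<open>norm a\<close> because
    \<open>trace_norm a\<close> is at most 1, so the absolute value equals
    \<open>t - norm a\<close>.\<close>
  also have "\<dots> = 1 - t" using aT(2) by (simp add: t_def abs_if field_simps)
  finally have nd: "trace_norm d = 1 - t" .
  show ?thesis
  \<comment> \<open>At \<open>t = 1\<close> the remainder \<open>d\<close> cannot be rescaled by
    \<open>1 / (1 - t)\<close>, but it vanishes, so \<open>e\<close> itself can serve as the second
    point.\<close>
  proof (cases "t = 1")
    case True
    then have "d = 0" using norm_le_trace_norm[OF d] nd by simp
    then have "a = e" using True by (simp add: d_def)
    then have "amenable trace_class trace_norm a e e t" using e eball True by (simp add: amenable_def)
    then show ?thesis using that by (simp add: t_def)
  next
    case False
    then have t1: "t < 1" using t by simp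
    define y where "y = (1 / (1 - t)) *\<^sub>R d"
    have "y \<in> unit_ball trace_class trace_norm"
      using trace_class_scaleR[OF d, of "1 / (1 - t)"] trace_norm_scaleR[OF d, of "1 / (1 - t)"] t1 nd
      by (simp add: unit_ball_def y_def)
    moreover have "a = t *\<^sub>R e + (1 - t) *\<^sub>R y" using t1 by (simp add: y_def d_def)
    ultimately have "amenable trace_class trace_norm a e y t" using e t by (simp add: amenable_def)
    then show ?thesis using that by (simp add: t_def)
  qed
qed

lemma lambda_function_ge:
  assumes "amenable X N x e y t"
  shows "t \<le> lambda_function X N x"
  unfolding lambda_function_def
proof (rule cSup_upper)
  show "t \<in> {t. \<exists>e y. amenable X N x e y t}" using assms by blast
  show "bdd_above {t. \<exists>e y. amenable X N x e y t}" by (rule bdd_aboveI[of _ 1]) (auto simp: amenable_def)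
qed

theorem proposition2p1:
  shows "lambda_property (trace_class :: ('a::chilbert_space \<Rightarrow>\<^sub>L 'a) set) trace_norm \<and>
    (\<forall>a \<in> unit_ball (trace_class :: ('a \<Rightarrow>\<^sub>L 'a) set) trace_norm.
       lambda_function trace_class trace_norm a \<ge> (1 - trace_norm a + 2 * norm a) / 2)"
proof
  show ge: "\<forall>a \<in> unit_ball (trace_class :: ('a \<Rightarrow>\<^sub>L 'a) set) trace_norm.
      lambda_function trace_class trace_norm a \<ge> (1 - trace_norm a + 2 * norm a) / 2"
    using amenable_triplet_exists lambda_function_ge by (metis order_trans)
  have "lambda_function trace_class trace_norm a > 0"
    if a: "a \<in> unit_ball trace_class trace_norm" for a :: "'a \<Rightarrow>\<^sub>L 'a"
  proof -
    \<comment> \<open>In the ball \<open>1 - trace_norm a\<close> is nonnegative; it is 1 for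
      \<open>a = 0\<close>, and otherwise \<open>norm a\<close> is positive.\<close>
    have "0 < 1 - trace_norm a + 2 * norm a"
    proof (cases "a = 0")
      case False
      then have "0 < norm a" by simp
      then show ?thesis using a by (simp add: unit_ball_def add_nonneg_pos)
    qed (simp add: trace_norm_0)
    then show ?thesis using ge a by (smt (verit) divide_pos_pos)
  qed
  moreover have "\<exists>e. e extreme_point_of unit_ball (trace_class :: ('a \<Rightarrow>\<^sub>L 'a) set) trace_norm"
  proof -
    have "(0 :: 'a \<Rightarrow>\<^sub>L 'a) \<in> unit_ball trace_class trace_norm"
      by (simp add: unit_ball_def trace_class_0 trace_norm_0)
    \<comment> \<open>Any triplet amenable to 0 contains an extreme point, which covers the zero
      space as well.\<close>
    then show ?thesis by (rule amenable_triplet_exists) (auto simp: amenable_def)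
  qed
  ultimately show "lambda_property (trace_class :: ('a \<Rightarrow>\<^sub>L 'a) set) trace_norm"
    by (simp add: lambda_property_def)
qed

end
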